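(* Fix $\alpha>0$ and for each integer $n\ge2$ let $\pi_{n,t}$ be the distribution of the number $q$ of customers at time $t\ge0$, and $\nu_n$ the stationary distribution, of the continuous-time $M/M/n$ queue with arrival rate $\lambda_n=n-n^{1-\alpha}$ and service rate $1$. Let $r_n=\max\{n-q,0\}$ be the number of idle servers. (i) If $\alpha\in(1/2,\infty)$, then for every $t\ge0$ and every initial distribution $\pi_{n,0}$, $$\mathbb P_{\pi_{n,t}}[r_n>0]\le 4e\pi\, n^{\frac12-\alpha}+2\sqrt{e\pi}\,n^{\frac14-\frac\alpha2}\,e^{-C_n(\sqrt n-\sqrt{\lambda_n})^2t}\,\chi(\pi_{n,0},\nu_n),$$ where $C_n>0$ does not depend on $t$ or $\pi_{n,0}$, $\lim_{n\to\infty}C_n=1$ if $\alpha\in(1/2,1)$, and $C_n=1$ if $\alpha\in[1,\infty)$. (In the constants, $\pi$ is the number $3.14\ldots$.) (ii) If $\alpha\in(0,1/2)$, there is a constant $\kappa>0$ (not depending on $n$, $t$ or $\pi_{n,0}$) and numbers $D_n>0$ (not depending on $t$ or $\pi_{n,0}$) with $\lim_{n\to\infty}D_n=1/25$ such that for every $t\ge0$ and every $\pi_{n,0}$, $$\mathbb P_{\pi_{n,t}}[r_n>0]\ge 1-\kappa\,n^{\alpha-\frac12}e^{-n^{\frac12-\alpha}}-e^{-D_nt}\,\chi(\pi_{n,0},\nu_n).$$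
   Context: The $M/M/n$ queue with arrival rate $\lambda$ and service rate $1$ is the continuous-time birth-and-death Markov chain on $\mathbb Z_{\ge0}$ (state = number of customers) with birth rate $\lambda$ in every state and death rate $\min\{n,q\}$ in state $q$. For $0<\lambda<n$ it has a unique stationary distribution. For probability distributions $P,Q$ on a countable set $S$ with $P$ absolutely continuous with respect to $Q$, $\chi^2(P,Q)=\sum_{x\in S}\frac{(P(x)-Q(x))^2}{Q(x)}$ and $\chi(P,Q)=\sqrt{\chi^2(P,Q)}\in[0,\infty]$; if $\chi(\pi_{n,0},\nu_n)=\infty$ the bounds are vacuous. *)

theory Defs
  imports "HOL-Probability.Probability"
begin

text \<open>
  \<open>P t x\<close> is the law at time \<open>t\<close> of the chain started in \<open>x\<close>. The entries of \<open>q\<close> are the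
  transition rates, with \<open>q x x = - (\<Sum>y\<noteq>x. q x y)\<close> on the diagonal. When the rates are bounded,
  as they are for the M/M/n queue, \<open>q\<close> determines \<open>P t\<close> for all \<open>t \<ge> 0\<close>; the values at
  negative times are irrelevant.
\<close>

definition ctmc_semigroup :: "('a \<Rightarrow> 'a \<Rightarrow> real) \<Rightarrow> (real \<Rightarrow> 'a \<Rightarrow> 'a pmf) \<Rightarrow> bool" where
  "ctmc_semigroup q P \<longleftrightarrow>
     (\<forall>x. P 0 x = return_pmf x) \<and>
     (\<forall>s\<ge>0. \<forall>t\<ge>0. \<forall>x. P (s + t) x = bind_pmf (P s x) (P t)) \<and>
     (\<forall>x y. ((\<lambda>t. pmf (P t x) y) has_real_derivative q x y) (at 0 within {0..}))"

definition law_at :: "(real \<Rightarrow> 'a \<Rightarrow> 'a pmf) \<Rightarrow> 'a pmf \<Rightarrow> real \<Rightarrow> 'a pmf" where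
  "law_at P \<mu> t = bind_pmf \<mu> (P t)"

definition stationary :: "(real \<Rightarrow> 'a \<Rightarrow> 'a pmf) \<Rightarrow> 'a pmf \<Rightarrow> bool" where
  "stationary P \<nu> \<longleftrightarrow> (\<forall>t\<ge>0. law_at P \<nu> t = \<nu>)"

definition birth_death_rates :: "(nat \<Rightarrow> real) \<Rightarrow> (nat \<Rightarrow> real) \<Rightarrow> nat \<Rightarrow> nat \<Rightarrow> real" where
  "birth_death_rates b d x y =
     (if y = x + 1 then b x
      else if x = y + 1 then d x
      else if x = y then - (b x + (if x = 0 then 0 else d x))
      else 0)"

definition mmn_rates :: "nat \<Rightarrow> real \<Rightarrow> nat \<Rightarrow> nat \<Rightarrow> real" where
  "mmn_rates n lam = birth_death_rates (\<lambda>q. lam) (\<lambda>q. real (min n q))"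

definition mmn_semigroup :: "nat \<Rightarrow> real \<Rightarrow> (real \<Rightarrow> nat \<Rightarrow> nat pmf) \<Rightarrow> bool" where
  "mmn_semigroup n lam P \<longleftrightarrow> ctmc_semigroup (mmn_rates n lam) P"

definition arrival_rate :: "real \<Rightarrow> nat \<Rightarrow> real" where
  "arrival_rate \<alpha> n = real n - real n powr (1 - \<alpha>)"

definition idle_servers :: "nat \<Rightarrow> nat \<Rightarrow> int" where
  "idle_servers n q = max (int n - int q) 0"

text \<open>
  In \<^typ>\<open>ennreal\<close> we have \<open>0 / 0 = 0\<close> and \<open>a / 0 = \<infinity>\<close> for \<open>a > 0\<close>: points outside both supports
  do not contribute, and the divergence is infinite unless \<open>p\<close> is absolutely continuous
  with respect to \<open>q\<close>.
\<close>

definition chi_sq :: "'a pmf \<Rightarrow> 'a pmf \<Rightarrow> ennreal" where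
  "chi_sq p q =
     (\<integral>\<^sup>+ x. ennreal ((pmf p x - pmf q x)\<^sup>2) / ennreal (pmf q x) \<partial>count_space UNIV)"

definition chi :: "'a pmf \<Rightarrow> 'a pmf \<Rightarrow> ereal" where
  "chi p q = (if chi_sq p q = \<infinity> then \<infinity> else ereal (sqrt (enn2real (chi_sq p q))))"

end

theory Submission
  imports Defs
begin

text \<open>
  Stationarity forces detailed balance, which determines \<open>\<nu>\<close>. Testing the law at time \<open>t\<close> against
  the indicator of the event of an idle server and moving the semigroup onto the indicator, the
  deviation from stationarity is at most \<open>\<chi>(\<mu>, \<nu>)\<close> times the \<open>L\<^sup>2(\<nu>)\<close> norm of the evolved
  centred indicator, which decays at rate \<open>\<gamma>\<close> as soon as the Poincare inequality with constant \<open>\<gamma>\<close>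
  holds. The Poincare inequality is dual to a weighted Hardy inequality for partial sums, and that
  follows from a positive supersolution of the chain acting on increments. A constant growth ratio
  of this supersolution handles \<open>\<alpha> \<ge> 1\<close>; otherwise the ratio grows linearly to its final value over
  the last \<open>\<surd>n\<close> states below \<open>n\<close>. The stationary idle probability is estimated by comparing
  \<open>\<nu>\<close> below \<open>n\<close> with a Gaussian profile of width \<open>\<surd>n\<close>.
\<close>

section \<open>Expectations under a probability mass function\<close>

text \<open>The hypotheses give only the right derivative at time 0 of each single transition
  probability. Derivatives at later times, differentiation under the expectation and the passage
  from a differential inequality to decay are therefore all done with right derivatives and bounded
  test functions; the bounded exit rates supply the domination. The rate
  \<open>(sqrt n - sqrt lam)^2\<close> is the maximum over \<open>e\<close> of
  \<open>n * e / (1 + e) - lam * e\<close>, the gain in the states \<open>x \<ge> n\<close> when the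
  supersolution has ratio \<open>1 + e\<close>; it is attained at
  \<open>1 + e = sqrt (n / lam)\<close>. The obstacle lies below \<open>n\<close>: a constant ratio
  must satisfy \<open>lam * e \<le> 1 - \<gamma>\<close> at \<open>x = 0\<close>, and for the
  optimal \<open>e\<close> the left side is about \<open>(n - lam) / 2\<close>. When
  \<open>n - lam\<close> is large, the ratio must fall back to 1 far below \<open>n\<close>. Width
  \<open>sqrt n\<close> balances the two costs, the drift deficit \<open>n - x\<close> on the ramp
  and the slope of the ramp, each of order \<open>sqrt n * e\<close>. Everything is governed by
  \<open>y = n powr (1/2 - \<alpha>)\<close>, for which \<open>n - lam = sqrt n * y\<close>: a small
  \<open>y\<close> leaves room for the optimal \<open>e\<close>, while for \<open>y \<ge> 1\<close>
  the smaller choice \<open>e = 1 / (4 * sqrt n)\<close> already gives a constant gap.\<close>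

lemma integrable_pmf_bounded:
  fixes f :: "'a \<Rightarrow> real"
  assumes "\<And>x. \<bar>f x\<bar> \<le> B"
  shows "integrable (measure_pmf p) f"
  by (rule measure_pmf.integrable_const_bound[where B = B]) (auto simp: assms)

lemma abs_expectation_pmf_le:
  fixes f :: "'a \<Rightarrow> real"
  assumes "\<And>x. \<bar>f x\<bar> \<le> B"
  shows "\<bar>measure_pmf.expectation p f\<bar> \<le> B"
proof -
  have i: "integrable (measure_pmf p) f" by (rule integrable_pmf_bounded[OF assms])
  have "measure_pmf.expectation p f \<le> B"
    using assms by (intro measure_pmf.integral_le_const i) (auto simp: abs_le_iff)
  moreover have "- B \<le> measure_pmf.expectation p f"
    using assms by (intro measure_pmf.integral_ge_const i) (auto simp: abs_le_iff minus_le_iff)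
  ultimately show ?thesis by auto
qed

lemma expectation_bind_pmf:
  fixes f :: "'a \<Rightarrow> real"
  assumes "\<And>x. \<bar>f x\<bar> \<le> B"
  shows "measure_pmf.expectation (bind_pmf p K) f
       = measure_pmf.expectation p (\<lambda>x. measure_pmf.expectation (K x) f)"
proof -
  \<comment> \<open>Adding \<open>B\<close> makes the integrand nonnegative, so the composition rule
    for \<open>nn_integral\<close> over \<open>bind_pmf\<close> applies; the shift is removed at the
    end.\<close>
  have nn: "0 \<le> f x + B" for x using assms[of x] by auto
  have B: "\<bar>f x + B\<bar> \<le> 2 * B" for x using assms[of x] by auto
  have i: "integrable (measure_pmf q) (\<lambda>x. f x + B)" for q :: "'a pmf"
    by (rule integrable_pmf_bounded[OF B])
  have i2: "integrable (measure_pmf p) (\<lambda>x. measure_pmf.expectation (K x) (\<lambda>x. f x + B))"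
    by (rule integrable_pmf_bounded[where B = "2 * B"]) (rule abs_expectation_pmf_le[OF B])
  have "ennreal (measure_pmf.expectation (bind_pmf p K) (\<lambda>x. f x + B))
      = (\<integral>\<^sup>+x. ennreal (f x + B) \<partial>bind_pmf p K)"
    by (rule nn_integral_eq_integral[symmetric]) (auto intro: i nn)
  also have "\<dots> = (\<integral>\<^sup>+x. ennreal (measure_pmf.expectation (K x) (\<lambda>x. f x + B)) \<partial>p)"
    by (simp add: nn_integral_eq_integral[OF i] nn)
  also have "\<dots> = ennreal (measure_pmf.expectation p (\<lambda>x. measure_pmf.expectation (K x) (\<lambda>x. f x + B)))"
    by (rule nn_integral_eq_integral) (auto intro!: i2 integral_nonneg_AE nn)
  finally have *: "measure_pmf.expectation (bind_pmf p K) (\<lambda>x. f x + B)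
      = measure_pmf.expectation p (\<lambda>x. measure_pmf.expectation (K x) (\<lambda>x. f x + B))"
    by (subst (asm) ennreal_inj) (auto intro!: integral_nonneg_AE nn)
  have e: "measure_pmf.expectation q (\<lambda>x. f x + B) = measure_pmf.expectation q f + B" for q
    by (subst Bochner_Integration.integral_add) (auto intro: integrable_pmf_bounded[OF assms])
  have "integrable (measure_pmf p) (\<lambda>x. measure_pmf.expectation (K x) f)"
    by (rule integrable_pmf_bounded[where B = B]) (rule abs_expectation_pmf_le[OF assms])
  then have e2: "measure_pmf.expectation p (\<lambda>x. measure_pmf.expectation (K x) f + B)
     = measure_pmf.expectation p (\<lambda>x. measure_pmf.expectation (K x) f) + B"
    by (subst Bochner_Integration.integral_add) auto
  show ?thesis using * unfolding e e2 by simp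
qed

lemma expectation_pmf_sums:
  fixes f :: "nat \<Rightarrow> real"
  assumes "\<And>x. \<bar>f x\<bar> \<le> B"
  shows "(\<lambda>x. pmf p x * f x) sums measure_pmf.expectation p f"
proof -
  have i: "integrable (measure_pmf p) f" by (rule integrable_pmf_bounded[OF assms])
  then have i: "integrable (count_space UNIV) (\<lambda>x. pmf p x * f x)"
    unfolding measure_pmf_eq_density by (subst (asm) integrable_density) auto
  have "measure_pmf.expectation p f = integral\<^sup>L (count_space UNIV) (\<lambda>x. pmf p x * f x)"
    unfolding measure_pmf_eq_density by (subst integral_density) auto
  with sums_integral_count_space_nat[OF i] show ?thesis by simp
qed

lemma prob_sums:
  "(\<lambda>x. pmf p x * indicator A x) sums measure_pmf.prob p (A :: nat set)"
proof -
  have "(\<lambda>x. pmf p x * indicator A x) sums measure_pmf.expectation p (indicator A)"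
    by (rule expectation_pmf_sums[where B = 1]) (auto simp: indicator_def)
  then show ?thesis by simp
qed

lemma pmf_sums: "pmf p sums (1 :: real)" for p :: "nat pmf"
  using prob_sums[of p UNIV] by simp

text \<open>With an extra slope \<open>c > 0\<close> allowed, the set of times at which
  \<open>G\<close> still lies below the line through \<open>(a, G a)\<close> is closed. At its last
  point \<open>T < b\<close> the right derivative, being below \<open>c\<close>, would carry the
  bound a little further; hence \<open>T = b\<close>, and \<open>c\<close> can be made arbitrarily
  small.\<close>

lemma nonincreasing_of_right_derivative:
  fixes G :: "real \<Rightarrow> real"
  assumes ab: "a \<le> b" and cont: "continuous_on {a..b} G"
    and der: "\<And>t. a \<le> t \<Longrightarrow> t < b \<Longrightarrow> (G has_real_derivative G' t) (at t within {t..})"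
    and neg: "\<And>t. a \<le> t \<Longrightarrow> t < b \<Longrightarrow> G' t \<le> 0"
  shows "G b \<le> G a"
proof (rule field_le_epsilon)
  fix e :: real assume e: "0 < e"
  define c where "c = e / (b - a + 1)"
  have c: "0 < c" using e ab by (simp add: c_def)
  define S where "S = {t \<in> {a..b}. G t - c * t \<le> G a - c * a}"
  have cont': "continuous_on {a..b} (\<lambda>t. G t - c * t)"
    by (intro continuous_intros cont)
  have "S = {a..b} \<inter> (\<lambda>t. G t - c * t) -` {..G a - c * a}" by (auto simp: S_def)
  then have "closed S" by (simp add: continuous_closed_preimage[OF cont'])
  have "a \<in> S" using ab by (simp add: S_def)
  have bdd: "bdd_above S" by (auto simp: S_def bdd_above_def)
  define T where "T = Sup S"
  have TS: "T \<in> S" unfolding T_def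
    by (rule closed_contains_Sup) (use \<open>a \<in> S\<close> bdd \<open>closed S\<close> in auto)
  have "T = b"
  proof (rule ccontr)
    assume "T \<noteq> b"
    then have T: "a \<le> T" "T < b" using TS by (auto simp: S_def)
    from der[OF T] have "((\<lambda>y. (G y - G T) / (y - T)) \<longlongrightarrow> G' T) (at T within {T..})"
      by (simp add: has_field_derivative_iff)
    then have "\<forall>\<^sub>F y in at T within {T..}. (G y - G T) / (y - T) < c"
      by (rule order_tendstoD) (use neg[OF T] c in linarith)
    then obtain d where d: "d > 0"
      "\<And>y. y \<in> {T..} \<Longrightarrow> y \<noteq> T \<Longrightarrow> dist y T < d \<Longrightarrow> (G y - G T) / (y - T) < c"
      unfolding eventually_at by blast
    define y where "y = min b (T + d / 2)"
    have y: "T < y" "y \<le> b" "dist y T < d" using d(1) T by (auto simp: y_def dist_real_def)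
    have "(G y - G T) / (y - T) < c" using d(2)[of y] y by auto
    then have "G y - G T \<le> c * (y - T)" using y by (simp add: divide_simps)
    then have "y \<in> S" using TS y T by (auto simp: S_def algebra_simps)
    then have "y \<le> T" unfolding T_def by (rule cSup_upper) (rule bdd)
    with y show False by simp
  qed
  with TS have "G b \<le> G a + c * (b - a)" by (auto simp: S_def algebra_simps)
  also have "c * (b - a) \<le> e" using e ab by (simp add: c_def divide_simps)
  finally show "G b \<le> G a + e" by simp
qed

section \<open>Transition operators of a continuous-time Markov chain\<close>

definition transition_op :: "(real \<Rightarrow> 'a \<Rightarrow> 'a pmf) \<Rightarrow> real \<Rightarrow> ('a \<Rightarrow> real) \<Rightarrow> 'a \<Rightarrow> real" where
  "transition_op P t f x = measure_pmf.expectation (P t x) f"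

lemma abs_transition_op_le:
  assumes "\<And>x. \<bar>f x\<bar> \<le> B"
  shows "\<bar>transition_op P t f x\<bar> \<le> B"
  unfolding transition_op_def by (rule abs_expectation_pmf_le[OF assms])

text \<open>Being in \<open>x\<close> at time \<open>r\<close> and again at \<open>r + s\<close>
  shows that \<open>\<psi> s = 1 - pmf (P s x) x\<close> is subadditive. So
  \<open>\<psi> t / t\<close> is at most the same quotient at \<open>t / k\<close>, which tends to
  the exit rate. The infinitesimal rate thus controls all times, with no error term.\<close>

lemma ctmc_exit_probability_le:
  assumes P: "ctmc_semigroup q P" and t: "0 \<le> t"
  shows "1 - pmf (P t x) x \<le> - q x x * t"
proof (cases "t = 0")
  case True
  then show ?thesis using P by (simp add: ctmc_semigroup_def)
next
  case False
  with t have t: "0 < t" by simp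
  define \<psi> where "\<psi> s = 1 - pmf (P s x) x" for s
  have \<psi>0: "\<psi> 0 = 0" using P by (simp add: \<psi>_def ctmc_semigroup_def)
  have sub: "\<psi> (r + s) \<le> \<psi> r + \<psi> s" if "0 \<le> r" "0 \<le> s" for r s
  proof -
    have "P (r + s) x = bind_pmf (P r x) (P s)"
      using P that unfolding ctmc_semigroup_def by blast
    then have "pmf (P (r + s) x) x = measure_pmf.expectation (P r x) (\<lambda>y. pmf (P s y) x)"
      by (simp add: pmf_bind)
    also have "\<dots> \<ge> measure_pmf.expectation (P r x) (\<lambda>y. pmf (P s x) x * indicator {x} y)"
      by (intro integral_mono integrable_pmf_bounded[where B = 1])
         (auto simp: pmf_le_1 split: split_indicator)
    also have "measure_pmf.expectation (P r x) (\<lambda>y. pmf (P s x) x * indicator {x} y)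
        = pmf (P s x) x * pmf (P r x) x"
      by (simp add: measure_pmf_single)
    finally have "pmf (P s x) x * pmf (P r x) x \<le> pmf (P (r + s) x) x" .
    moreover have "0 \<le> (1 - pmf (P s x) x) * (1 - pmf (P r x) x)"
      by (simp add: pmf_le_1)
    ultimately show ?thesis by (simp add: \<psi>_def algebra_simps)
  qed
  have mult: "\<psi> (real k * h) \<le> real k * \<psi> h" if "0 \<le> h" for k h
  proof (induction k)
    case 0
    then show ?case by (simp add: \<psi>0)
  next
    case (Suc k)
    have "\<psi> (real (Suc k) * h) \<le> \<psi> (real k * h) + \<psi> h"
      using sub[of "real k * h" h] that by (simp add: algebra_simps)
    with Suc show ?case by (simp add: algebra_simps)
  qed
  have "((\<lambda>s. pmf (P s x) x) has_real_derivative q x x) (at 0 within {0..})"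
    using P by (simp add: ctmc_semigroup_def)
  then have "(\<psi> has_real_derivative - q x x) (at 0 within {0..})"
    unfolding \<psi>_def by (auto intro!: derivative_eq_intros)
  then have "((\<lambda>s. \<psi> s / s) \<longlongrightarrow> - q x x) (at 0 within {0..})"
    by (simp add: has_field_derivative_iff \<psi>0)
  moreover have "filterlim (\<lambda>k. t / real (Suc k)) (at 0 within {0..}) sequentially"
    using LIMSEQ_Suc[OF lim_const_over_n[of t]] t
    by (auto simp: filterlim_at intro!: always_eventually)
  ultimately have lim: "(\<lambda>k. \<psi> (t / real (Suc k)) / (t / real (Suc k))) \<longlonglongrightarrow> - q x x"
    by (rule filterlim_compose)
  have "\<psi> t / t \<le> \<psi> (t / real (Suc k)) / (t / real (Suc k))" for k
    using mult[of "t / real (Suc k)" "Suc k"] t by (simp add: field_simps del: of_nat_Suc)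
  then have "\<psi> t / t \<le> - q x x"
    by (intro LIMSEQ_le_const[OF lim]) auto
  with t show ?thesis by (simp add: \<psi>_def field_simps)
qed

lemma transition_op_add:
  assumes P: "ctmc_semigroup q P" and "0 \<le> s" "0 \<le> t" and f: "\<And>x. \<bar>f x\<bar> \<le> B"
  shows "transition_op P (s + t) f x = transition_op P s (transition_op P t f) x"
proof -
  have "P (s + t) x = bind_pmf (P s x) (P t)"
    using assms unfolding ctmc_semigroup_def by blast
  then show ?thesis
    unfolding transition_op_def by (simp add: expectation_bind_pmf[OF f])
qed

lemma transition_op_0:
  assumes "ctmc_semigroup q P"
  shows "transition_op P 0 f = f"
  using assms by (simp add: ctmc_semigroup_def transition_op_def fun_eq_iff)

text \<open>By the semigroup property only the mass that has left \<open>x\<close> after time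
  \<open>s\<close> contributes, each unit at most \<open>2 * B\<close>. The resulting Lipschitz
  constant is uniform in the state, which later permits dominated convergence.\<close>

lemma transition_op_diff_le:
  assumes P: "ctmc_semigroup q P" and s: "0 \<le> s" and t: "0 \<le> t" and f: "\<And>x. \<bar>f x\<bar> \<le> B"
    and Q: "\<And>x. - q x x \<le> Q"
  shows "\<bar>transition_op P (t + s) f x - transition_op P t f x\<bar> \<le> 2 * B * Q * s"
proof -
  define g where "g = transition_op P t f"
  have g: "\<bar>g y\<bar> \<le> B" for y unfolding g_def by (rule abs_transition_op_le[OF f])
  have ig: "integrable (measure_pmf p) g" for p by (rule integrable_pmf_bounded[OF g])
  have B: "0 \<le> B" using f[of x] by linarith
  have gd: "\<bar>g y - g x\<bar> \<le> 2 * B * indicator (- {x}) y" for y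
    using g[of x] g[of y] by (auto split: split_indicator)
  have "transition_op P (t + s) f x - transition_op P t f x
      = measure_pmf.expectation (P s x) (\<lambda>y. g y - g x)"
    using transition_op_add[OF P s t f] ig
    by (simp add: g_def[symmetric] add.commute transition_op_def)
  also have "\<bar>\<dots>\<bar> \<le> measure_pmf.expectation (P s x) (\<lambda>y. \<bar>g y - g x\<bar>)"
    by (rule integral_abs_bound)
  also have "\<dots> \<le> measure_pmf.expectation (P s x) (\<lambda>y. 2 * B * indicator (- {x}) y)"
    using gd B by (intro integral_mono integrable_pmf_bounded[where B = "2 * B"])
      (auto split: split_indicator simp: order_trans[OF gd])
  also have "\<dots> = 2 * B * (1 - pmf (P s x) x)"
    by (simp add: measure_pmf.prob_compl[of "{x}", simplified] Compl_eq_Diff_UNIV measure_pmf_single)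
  also have "\<dots> \<le> 2 * B * (- q x x * s)"
    using ctmc_exit_probability_le[OF P s, of x] B by (intro mult_left_mono) auto
  also have "\<dots> \<le> 2 * B * (Q * s)"
    using Q[of x] B s by (intro mult_left_mono mult_right_mono) auto
  finally show ?thesis by (simp add: mult.assoc)
qed

text \<open>Since the row of \<open>q\<close> sums to zero over the finite set \<open>S\<close>, the
  mass \<open>m s\<close> outside \<open>S\<close> has derivative zero at 0. Hence the remainder
  \<open>R\<close>, at most \<open>B * m s\<close>, is negligible, and a finite sum of entrywise
  derivatives remains even on an infinite state space.\<close>

lemma has_right_derivative_transition_op:
  assumes P: "ctmc_semigroup q P" and t: "0 \<le> t" and f: "\<And>x. \<bar>f x\<bar> \<le> B"
    and S: "finite S" "x \<in> S" "sum (q x) S = 0"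
  shows "((\<lambda>t. transition_op P t f x) has_real_derivative
      (\<Sum>y\<in>S. q x y * transition_op P t f y)) (at t within {t..})"
proof -
  define g where "g = transition_op P t f"
  have g: "\<bar>g y\<bar> \<le> B" for y unfolding g_def by (rule abs_transition_op_le[OF f])
  have B: "0 \<le> B" using f[of x] by linarith
  have ind: "measure_pmf.expectation p (indicator S) = (\<Sum>y\<in>S. pmf p y)" for p :: "'a pmf"
    using S by (simp add: measure_measure_pmf_finite)
  have pder: "((\<lambda>s. pmf (P s x) y) has_real_derivative q x y) (at 0 within {0..})" for y
    using P by (simp add: ctmc_semigroup_def)
  define R where "R s = transition_op P s g x - (\<Sum>y\<in>S. pmf (P s x) y * g y)" for s
  define m where "m s = 1 - (\<Sum>y\<in>S. pmf (P s x) y)" for s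
  have m0: "m 0 = 0" using P S by (simp add: m_def ctmc_semigroup_def pmf_return indicator_def if_distrib sum.delta' cong: if_cong)
  have R_le: "\<bar>R s\<bar> \<le> B * m s" for s
  proof -
    have "(\<Sum>y\<in>S. pmf (P s x) y * g y) = measure_pmf.expectation (P s x) (\<lambda>y. indicator S y * g y)"
      by (subst integral_measure_pmf_real[where A = S]) (use S in \<open>auto simp: indicator_def mult.commute intro!: sum.cong split: if_splits\<close>)
    then have "R s = measure_pmf.expectation (P s x) (\<lambda>y. g y - indicator S y * g y)"
      unfolding R_def transition_op_def
      by (subst Bochner_Integration.integral_diff)
         (auto intro!: integrable_pmf_bounded[where B = B] simp: g B split: split_indicator)
    also have "\<bar>\<dots>\<bar> \<le> measure_pmf.expectation (P s x) (\<lambda>y. \<bar>g y - indicator S y * g y\<bar>)"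
      by (rule integral_abs_bound)
    also have "\<dots> \<le> measure_pmf.expectation (P s x) (\<lambda>y. B * (1 - indicator S y))"
      using B by (intro integral_mono integrable_pmf_bounded[where B = B])
        (auto split: split_indicator simp: g)
    also have "\<dots> = B * m s"
      using ind[of "P s x"] by (simp add: m_def Bochner_Integration.integral_diff integrable_pmf_bounded[where B = 1])
    finally show ?thesis .
  qed
  have R0: "R 0 = 0" using R_le[of 0] m0 by simp
  have "(m has_real_derivative 0 - (\<Sum>y\<in>S. q x y)) (at 0 within {0..})"
    unfolding m_def by (intro derivative_intros pder)
  then have "((\<lambda>s. m s / s) \<longlongrightarrow> 0) (at 0 within {0..})"
    using S by (simp add: has_field_derivative_iff m0)
  then have "((\<lambda>s. B * (m s / s)) \<longlongrightarrow> B * 0) (at 0 within {0..})"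
    by (intro tendsto_intros)
  then have lim: "((\<lambda>s. B * (m s / s)) \<longlongrightarrow> 0) (at 0 within {0..})" by simp
  have "((\<lambda>s. R s / s) \<longlongrightarrow> 0) (at 0 within {0..})"
  proof (rule Lim_null_comparison[OF _ lim])
    show "\<forall>\<^sub>F s in at 0 within {0..}. norm (R s / s) \<le> B * (m s / s)"
      unfolding eventually_at_filter using R_le by (auto intro!: always_eventually simp: divide_simps)
  qed
  then have "(R has_real_derivative 0) (at 0 within {0..})"
    by (simp add: has_field_derivative_iff R0)
  then have "((\<lambda>s. R s + (\<Sum>y\<in>S. pmf (P s x) y * g y)) has_real_derivative 0 + (\<Sum>y\<in>S. q x y * g y)) (at 0 within {0..})"
    by (intro derivative_intros) (auto intro!: derivative_eq_intros pder)
  then have d0: "((\<lambda>s. transition_op P s g x) has_real_derivative (\<Sum>y\<in>S. q x y * g y)) (at 0 within {0..})"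
    by (simp add: R_def)
  \<comment> \<open>The semigroup property carries the derivative from time 0 to time
    \<open>t\<close>, with the evolved function \<open>g\<close> in place of
    \<open>f\<close>.\<close>
  have "((\<lambda>s. transition_op P (s - t) g x) has_real_derivative (\<Sum>y\<in>S. q x y * g y) * 1) (at t within {t..})"
  proof (rule DERIV_image_chain[unfolded o_def, where g = "\<lambda>s. s - t"])
    have "(\<lambda>s. s - t) ` {t..} = {0..}" by (auto simp: image_iff intro!: bexI[where x = "_ + t"])
    then show "((\<lambda>s. transition_op P s g x) has_real_derivative (\<Sum>y\<in>S. q x y * g y)) (at (t - t) within (\<lambda>s. s - t) ` {t..})"
      using d0 by simp
  qed (auto intro!: derivative_eq_intros)
  then have "((\<lambda>s. transition_op P (s - t) g x) has_real_derivative (\<Sum>y\<in>S. q x y * g y)) (at t within {t..})" by simp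
  then show ?thesis
    unfolding g_def[symmetric]
  proof (rule has_field_derivative_transform_within[OF _ zero_less_one])
    show "transition_op P (s - t) g x = transition_op P s f x" if "s \<in> {t..}" for s
      using transition_op_add[OF P _ t f, where s = "s - t" and x = x] that by (simp add: g_def)
  qed simp
qed

section \<open>The M/M/n queue\<close>

text \<open>Dominated convergence along sequences: the Lipschitz constant \<open>K\<close>, uniform
  in the state, dominates the difference quotients.\<close>

lemma has_right_derivative_expectation:
  fixes g :: "real \<Rightarrow> 'a \<Rightarrow> real"
  assumes der: "\<And>x. ((\<lambda>s. g s x) has_real_derivative g' x) (at t within {t..})"
    and lip: "\<And>s x. t \<le> s \<Longrightarrow> \<bar>g s x - g t x\<bar> \<le> K * (s - t)"
    and bd: "\<And>s x. t \<le> s \<Longrightarrow> \<bar>g s x\<bar> \<le> B"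
  shows "((\<lambda>s. measure_pmf.expectation p (g s)) has_real_derivative
      measure_pmf.expectation p g') (at t within {t..})"
  unfolding has_field_derivative_iff tendsto_at_iff_sequentially comp_def
proof (intro allI impI)
  fix X :: "nat \<Rightarrow> real"
  assume X: "\<forall>i. X i \<in> {t..} - {t}" and lim: "X \<longlonglongrightarrow> t"
  then have Xt: "t < X i" for i by (auto simp: less_le dest: spec[of _ i])
  have e: "(measure_pmf.expectation p (g (X i)) - measure_pmf.expectation p (g t)) / (X i - t)
      = measure_pmf.expectation p (\<lambda>x. (g (X i) x - g t x) / (X i - t))" for i
  proof -
    have "integrable (measure_pmf p) (g (X i))" "integrable (measure_pmf p) (g t)"
      using Xt[of i] by (auto intro!: integrable_pmf_bounded[where B = B] bd)
    then show ?thesis by simp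
  qed
  have "(\<lambda>i. measure_pmf.expectation p (\<lambda>x. (g (X i) x - g t x) / (X i - t)))
      \<longlonglongrightarrow> measure_pmf.expectation p g'"
  proof (rule integral_dominated_convergence[where w = "\<lambda>_. K"])
    show "AE x in measure_pmf p. (\<lambda>i. (g (X i) x - g t x) / (X i - t)) \<longlonglongrightarrow> g' x"
      using der X lim
      unfolding has_field_derivative_iff tendsto_at_iff_sequentially comp_def by auto
    show "AE x in measure_pmf p. norm ((g (X i) x - g t x) / (X i - t)) \<le> K" for i
      using lip[of "X i"] Xt[of i] by (auto simp: divide_simps)
  qed auto
  then show "(\<lambda>i. (measure_pmf.expectation p (g (X i)) - measure_pmf.expectation p (g t)) / (X i - t))
      \<longlonglongrightarrow> measure_pmf.expectation p g'"
    unfolding e .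
qed

text \<open>At \<open>x = 0\<close> the truncated \<open>x - 1\<close> is harmless, because the death rate \<open>min n 0\<close> vanishes.\<close>

definition mmn_generator :: "nat \<Rightarrow> real \<Rightarrow> (nat \<Rightarrow> real) \<Rightarrow> nat \<Rightarrow> real" where
  "mmn_generator n lam f x = lam * (f (Suc x) - f x) + real (min n x) * (f (x - 1) - f x)"

lemma sum_mmn_rates:
  "(\<Sum>y\<in>{x - 1, x, Suc x}. mmn_rates n lam x y * f y) = mmn_generator n lam f x"
  by (cases x) (auto simp: mmn_rates_def birth_death_rates_def mmn_generator_def algebra_simps)

locale mmn_queue =
  fixes n :: nat and lam :: real and P :: "real \<Rightarrow> nat \<Rightarrow> nat pmf" and \<nu> :: "nat pmf"
  assumes lam_pos: "0 < lam" and lam_less: "lam < real n"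
    and semigroup: "mmn_semigroup n lam P" and stat: "stationary P \<nu>"
begin

lemma ctmc: "ctmc_semigroup (mmn_rates n lam) P"
  using semigroup by (simp add: mmn_semigroup_def)

lemma exit_rate_le: "- mmn_rates n lam x x \<le> lam + real n"
  using lam_pos by (auto simp: mmn_rates_def birth_death_rates_def)

lemma has_right_derivative_mmn:
  assumes "0 \<le> t" "\<And>x. \<bar>f x\<bar> \<le> B"
  shows "((\<lambda>t. transition_op P t f x) has_real_derivative
      mmn_generator n lam (transition_op P t f) x) (at t within {t..})"
proof -
  have "sum (mmn_rates n lam x) {x - 1, x, Suc x} = 0"
    using sum_mmn_rates[of n lam x "\<lambda>_. 1"] by (simp add: mmn_generator_def)
  from has_right_derivative_transition_op[OF ctmc assms _ _ this] show ?thesis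
    by (simp only: sum_mmn_rates) simp
qed

lemma transition_op_diff_le_mmn:
  assumes "0 \<le> t" "t \<le> s" "\<And>x. \<bar>f x\<bar> \<le> B"
  shows "\<bar>transition_op P s f x - transition_op P t f x\<bar> \<le> 2 * B * (lam + real n) * (s - t)"
  using transition_op_diff_le[OF ctmc _ assms(1,3) exit_rate_le, where s = "s - t" and x = x] assms(2) by simp

section \<open>Stationary law of the queue: flux balance and geometric tail\<close>

lemma expectation_transition_op:
  assumes "0 \<le> t" "\<And>x. \<bar>f x\<bar> \<le> B"
  shows "measure_pmf.expectation \<mu> (transition_op P t f)
       = measure_pmf.expectation (law_at P \<mu> t) f"
  by (simp add: law_at_def expectation_bind_pmf[OF assms(2)] transition_op_def[abs_def])

lemma expectation_transition_op_stationary: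
  assumes "0 \<le> t" "\<And>x. \<bar>f x\<bar> \<le> B"
  shows "measure_pmf.expectation \<nu> (transition_op P t f) = measure_pmf.expectation \<nu> f"
  using expectation_transition_op[OF assms] stat assms(1) by (simp add: stationary_def)

text \<open>Under \<open>\<nu>\<close> the expectation of the evolved \<open>f\<close> is constant
  in time, and its right derivative at 0 is the expectation of the generator.\<close>

lemma expectation_generator:
  assumes f: "\<And>x. \<bar>f x\<bar> \<le> B"
  shows "measure_pmf.expectation \<nu> (mmn_generator n lam f) = 0"
proof -
  have "((\<lambda>s. measure_pmf.expectation \<nu> (transition_op P s f)) has_real_derivative
      measure_pmf.expectation \<nu> (mmn_generator n lam (transition_op P 0 f))) (at 0 within {0..})"
    by (rule has_right_derivative_expectation[where B = B and K = "2 * B * (lam + real n)"])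
       (use has_right_derivative_mmn[OF _ f] transition_op_diff_le_mmn[OF order_refl _ f]
          abs_transition_op_le[of f B P, OF f] in auto)
  moreover have "((\<lambda>s. measure_pmf.expectation \<nu> (transition_op P s f)) has_real_derivative 0)
      (at 0 within {0..})"
    by (rule has_field_derivative_transform_within[OF DERIV_const zero_less_one])
       (auto simp: expectation_transition_op_stationary[OF _ f])
  ultimately have "measure_pmf.expectation \<nu> (mmn_generator n lam (transition_op P 0 f)) = 0"
    unfolding has_field_derivative_iff
    by (rule tendsto_unique[rotated]) (simp add: at_within_Ici_at_right)
  then show ?thesis by (simp add: transition_op_0[OF ctmc])
qed

text \<open>Applied to the indicator of \<open>{..k}\<close>, the generator sees only the edge
  between \<open>k\<close> and \<open>Suc k\<close>; stationarity then says that the net flux across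
  this edge vanishes.\<close>

lemma detailed_balance: "real (min n (Suc k)) * pmf \<nu> (Suc k) = lam * pmf \<nu> k"
proof -
  define f :: "nat \<Rightarrow> real" where "f = indicator {..k}"
  have gen: "mmn_generator n lam f x
      = real (min n (Suc k)) * indicator {Suc k} x - lam * indicator {k} x" for x
    by (cases x) (auto simp: mmn_generator_def f_def indicator_def)
  have "measure_pmf.expectation \<nu> (mmn_generator n lam f) = 0"
    by (rule expectation_generator[where B = 1]) (auto simp: f_def indicator_def)
  moreover have "measure_pmf.expectation \<nu> (mmn_generator n lam f)
      = real (min n (Suc k)) * pmf \<nu> (Suc k) - lam * pmf \<nu> k"
    unfolding gen
    by (subst Bochner_Integration.integral_diff)
       (use lam_pos in \<open>auto simp: measure_pmf_single
          intro!: integrable_pmf_bounded[where B = "lam + real (Suc n)"] split: split_indicator\<close>)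
  ultimately show ?thesis by simp
qed

lemma n_pos: "0 < n"
  using lam_pos lam_less by linarith

lemma pmf_Suc: "pmf \<nu> (Suc k) = lam / real (min n (Suc k)) * pmf \<nu> k"
  using detailed_balance[of k] n_pos by (simp add: field_simps)

lemma pmf_pos: "0 < pmf \<nu> k"
proof -
  have "pmf \<nu> 0 \<noteq> 0"
  proof
    assume "pmf \<nu> 0 = 0"
    then have "pmf \<nu> k = 0" for k by (induction k) (simp_all add: pmf_Suc)
    then have "pmf \<nu> = (\<lambda>k. 0)" by auto
    with pmf_sums[of \<nu>] show False by (simp add: sums_iff)
  qed
  then have "0 < pmf \<nu> 0" by (simp add: less_le)
  then show ?thesis
    by (induction k) (use lam_pos n_pos in \<open>simp_all add: pmf_Suc\<close>)
qed

text \<open>Every edge from \<open>k\<close> upward has death rate \<open>n\<close>, so summing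
  detailed balance over these edges compares the tail with its own shift. The hypothesis admits
  \<open>k = n - 1\<close>, the case that \<open>idle_balance\<close> uses.\<close>

lemma tail_eq:
  assumes "n \<le> Suc k"
  shows "(real n - lam) * (1 - (\<Sum>i\<le>k. pmf \<nu> i)) = lam * pmf \<nu> k"
proof -
  have s1: "(\<lambda>i. pmf \<nu> (i + Suc k)) sums (1 - (\<Sum>i\<le>k. pmf \<nu> i))"
    using sums_split_initial_segment[OF pmf_sums[of \<nu>], of "Suc k"] by (simp add: lessThan_Suc_atMost)
  have s0: "(\<lambda>i. pmf \<nu> (i + k)) sums (1 - (\<Sum>i\<le>k. pmf \<nu> i) + pmf \<nu> k)"
    using sums_split_initial_segment[OF pmf_sums[of \<nu>], of k]
    by (simp add: lessThan_Suc_atMost[symmetric])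
  have "real n * pmf \<nu> (i + Suc k) = lam * pmf \<nu> (i + k)" for i
    using detailed_balance[of "i + k"] assms by (simp add: min_def)
  then have "(\<lambda>i. lam * pmf \<nu> (i + k)) sums (real n * (1 - (\<Sum>i\<le>k. pmf \<nu> i)))"
    using sums_mult[OF s1, of "real n"] by simp
  from sums_unique2[OF this sums_mult[OF s0, of lam]] show ?thesis
    by (simp add: algebra_simps)
qed

end

section \<open>Poincare inequality\<close>

text \<open>
  The condition says that the positive sequence \<open>u\<close> with \<open>u (x + 1) = (1 + \<epsilon> x) u x\<close> satisfies
  \<open>L g (x + 1) - L g x \<le> - \<gamma> u x\<close>, where \<open>L\<close> is the generator and \<open>g\<close> has increments \<open>u\<close>.
\<close>

definition gap_certificate :: "nat \<Rightarrow> real \<Rightarrow> real \<Rightarrow> (nat \<Rightarrow> real) \<Rightarrow> bool" where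
  "gap_certificate n lam \<gamma> \<epsilon> \<longleftrightarrow> (\<forall>x. 0 \<le> \<epsilon> x) \<and>
     (\<forall>x. lam * \<epsilon> x - real (min n x) * (\<epsilon> (x - 1) / (1 + \<epsilon> (x - 1))) \<le> (if x < n then 1 else 0) - \<gamma>)"

text \<open>A discrete Picone inequality: the difference of the two sides is the square
  \<open>(q * a - p * b)^2 / (p * q)\<close>.\<close>

lemma picone:
  fixes a b p q :: real
  assumes "0 < p" "0 < q"
  shows "(p - q) * (a\<^sup>2 / p - b\<^sup>2 / q) \<le> (a - b)\<^sup>2"
proof -
  have "(a - b)\<^sup>2 - (p - q) * (a\<^sup>2 / p - b\<^sup>2 / q) = (q * a - p * b)\<^sup>2 / (p * q)"
    using assms by (simp add: field_simps power2_eq_square)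
  also have "\<dots> \<ge> 0" using assms by simp
  finally show ?thesis by simp
qed

context mmn_queue
begin

text \<open>Picone's inequality turns the supersolution into a bound on weighted squares of partial
  sums. The last term is the price of stopping at \<open>N\<close>; it tends to 0 for bounded
  centred \<open>f\<close>.\<close>

lemma hardy_inequality:
  assumes cert: "gap_certificate n lam \<gamma> \<epsilon>"
  shows "\<gamma> * (\<Sum>k<N. (\<Sum>j\<le>k. pmf \<nu> j * f j)\<^sup>2 / pmf \<nu> k)
    \<le> lam * (\<Sum>j\<le>N. pmf \<nu> j * (f j)\<^sup>2) + real n * ((\<Sum>j\<le>N. pmf \<nu> j * f j)\<^sup>2 / pmf \<nu> N)"
proof -
  define u where "u j = (\<Prod>i<j. 1 + \<epsilon> i)" for j
  define S where "S k = (\<Sum>j\<le>k. pmf \<nu> j * f j)" for k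
  \<comment> \<open>The generator at \<open>j\<close> of any function with increments
    \<open>u\<close>. By detailed balance, \<open>pmf \<nu> j * c j\<close> for \<open>j > 0\<close>
    is also \<open>lam\<close> times the increment of \<open>pmf \<nu> * u\<close>, which is the
    form Picone's inequality needs.\<close>
  define c where "c j = lam * u j - real (min n j) * u (j - 1)" for j
  define A where "A j = (S j)\<^sup>2 / (pmf \<nu> j * u j)" for j
  have eps: "0 \<le> \<epsilon> x" for x using cert by (simp add: gap_certificate_def)
  have u_pos: "0 < u j" for j unfolding u_def by (intro prod_pos) (auto simp: add_pos_nonneg eps)
  have u_Suc: "u (Suc j) = (1 + \<epsilon> j) * u j" for j by (simp add: u_def)
  have u_mono: "u (j - 1) \<le> u j" for j
    using u_pos eps by (cases j) (auto simp: u_Suc algebra_simps less_imp_le)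
  have p: "0 < pmf \<nu> j" for j by (rule pmf_pos)
  have c_Suc: "c j - c (Suc j) \<ge> \<gamma> * u j" for j
  proof -
    have d: "real (min n (Suc j)) = real (min n j) + (if j < n then 1 else 0)" by auto
    have *: "real (min n j) * u (j - 1) = real (min n j) * (1 - \<epsilon> (j - 1) / (1 + \<epsilon> (j - 1))) * u j"
    proof (cases j)
      case (Suc i)
      have "1 + \<epsilon> i \<noteq> 0" using eps[of i] by linarith
      then have "u i = (1 - \<epsilon> i / (1 + \<epsilon> i)) * u (Suc i)" by (simp add: u_Suc field_simps)
      then show ?thesis using Suc by simp
    qed simp
    have "c j - c (Suc j) = ((if j < n then 1 else 0)
        - (lam * \<epsilon> j - real (min n j) * (\<epsilon> (j - 1) / (1 + \<epsilon> (j - 1))))) * u j"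
      unfolding c_def * diff_Suc_1 d u_Suc by (simp add: algebra_simps)
    also have "\<dots> \<ge> \<gamma> * u j"
      using cert u_pos[of j] unfolding gap_certificate_def
      by (intro mult_right_mono) (auto simp: algebra_simps dest: spec[of _ j])
    finally show ?thesis .
  qed
  have uA: "u j * A j = (S j)\<^sup>2 / pmf \<nu> j" for j
    using u_pos[of j] p[of j] by (simp add: A_def field_simps)
  \<comment> \<open>Summation by parts as an induction: the drop from \<open>c N\<close> to
    \<open>c (Suc N)\<close> pays for the new summand on the left, and Picone bounds
    \<open>c (Suc N) * (A (Suc N) - A N)\<close> by the new summand on the right.\<close>
  have "c N * A N + \<gamma> * (\<Sum>k<N. u k * A k) \<le> lam * (\<Sum>j\<le>N. pmf \<nu> j * (f j)\<^sup>2)"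
  proof (induction N)
    case 0
    show ?case using p[of 0]
      by (simp add: c_def A_def S_def u_def power2_eq_square)
  next
    case (Suc N)
    have "c (Suc N) * (A (Suc N) - A N) \<le> lam * (pmf \<nu> (Suc N) * (f (Suc N))\<^sup>2)"
    proof -
      define a where "a = pmf \<nu> (Suc N) * u (Suc N)"
      define b where "b = pmf \<nu> N * u N"
      have pos: "0 < a" "0 < b" using p u_pos by (simp_all add: a_def b_def)
      have "pmf \<nu> (Suc N) * c (Suc N) = lam * (a - b)"
        using detailed_balance[of N] by (simp add: c_def a_def b_def algebra_simps)
      then have "pmf \<nu> (Suc N) * (c (Suc N) * (A (Suc N) - A N))
          = lam * ((a - b) * ((S (Suc N))\<^sup>2 / a - (S N)\<^sup>2 / b))"
        by (simp add: A_def a_def b_def mult.assoc[symmetric])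
      also have "\<dots> \<le> lam * (S (Suc N) - S N)\<^sup>2"
        using picone[OF pos] lam_pos by (intro mult_left_mono) auto
      also have "S (Suc N) - S N = pmf \<nu> (Suc N) * f (Suc N)" by (simp add: S_def)
      also have "lam * (pmf \<nu> (Suc N) * f (Suc N))\<^sup>2
          = pmf \<nu> (Suc N) * (lam * (pmf \<nu> (Suc N) * (f (Suc N))\<^sup>2))"
        by (simp add: power2_eq_square)
      finally show ?thesis using p[of "Suc N"] by simp
    qed
    moreover have "0 \<le> A N" using p[of N] u_pos[of N] by (simp add: A_def)
    then have "\<gamma> * u N * A N \<le> (c N - c (Suc N)) * A N"
      by (intro mult_right_mono c_Suc)
    ultimately show ?case using Suc by (simp add: algebra_simps)
  qed
  moreover have "- (real n * ((S N)\<^sup>2 / pmf \<nu> N)) \<le> c N * A N"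
  proof -
    have "real (min n N) * u (N - 1) \<le> real n * u N"
      using u_mono[of N] u_pos by (intro mult_mono) (auto simp: less_imp_le)
    then have "- (real n * u N) \<le> c N"
      using lam_pos u_pos[of N] by (simp add: c_def) (smt (verit) mult_pos_pos)
    then have "- (real n * u N) * A N \<le> c N * A N"
      using p[of N] u_pos[of N] by (intro mult_right_mono) (auto simp: A_def)
    then show ?thesis using uA[of N] by (simp add: mult.assoc)
  qed
  ultimately show ?thesis by (simp add: uA S_def)
qed

section \<open>From the Hardy inequality to the Poincare inequality\<close>

lemma summation_by_parts_variance:
  "(\<Sum>j\<le>N. pmf \<nu> j * (f j)\<^sup>2) = (\<Sum>j\<le>N. pmf \<nu> j * f j) * f N
     - (\<Sum>k<N. (\<Sum>j\<le>k. pmf \<nu> j * f j) * (f (Suc k) - f k))"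
  by (induction N) (simp_all add: algebra_simps power2_eq_square)

lemma summation_by_parts_generator:
  "(\<Sum>j\<le>N. pmf \<nu> j * (f j * mmn_generator n lam f j))
    = lam * pmf \<nu> N * (f (Suc N) - f N) * f N - lam * (\<Sum>k<N. pmf \<nu> k * (f (Suc k) - f k)\<^sup>2)"
proof (induction N)
  case 0
  show ?case by (simp add: mmn_generator_def)
next
  case (Suc N)
  have "pmf \<nu> (Suc N) * mmn_generator n lam f (Suc N)
     = lam * pmf \<nu> (Suc N) * (f (Suc (Suc N)) - f (Suc N))
       + (real (min n (Suc N)) * pmf \<nu> (Suc N)) * (f N - f (Suc N))"
    by (simp add: mmn_generator_def algebra_simps)
  then have *: "pmf \<nu> (Suc N) * mmn_generator n lam f (Suc N)
     = lam * pmf \<nu> (Suc N) * (f (Suc (Suc N)) - f (Suc N)) + lam * pmf \<nu> N * (f N - f (Suc N))"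
    unfolding detailed_balance .
  have "pmf \<nu> (Suc N) * (f (Suc N) * mmn_generator n lam f (Suc N))
     = f (Suc N) * (pmf \<nu> (Suc N) * mmn_generator n lam f (Suc N))" by simp
  then show ?case
    unfolding sum.atMost_Suc Suc * by (simp add: algebra_simps power2_eq_square)
qed

text \<open>Mean zero replaces the partial sum by minus the tail, which is comparable to
  \<open>pmf \<nu> N\<close> once \<open>N \<ge> n\<close>.\<close>

lemma partial_sum_bound:
  assumes f: "\<And>x. \<bar>f x\<bar> \<le> B" and mean: "measure_pmf.expectation \<nu> f = 0" and N: "n \<le> N"
  shows "\<bar>\<Sum>j\<le>N. pmf \<nu> j * f j\<bar> \<le> B * (lam / (real n - lam)) * pmf \<nu> N"
proof -
  have "(\<lambda>j. pmf \<nu> (j + Suc N) * f (j + Suc N)) sums - (\<Sum>j\<le>N. pmf \<nu> j * f j)"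
    using sums_split_initial_segment[OF expectation_pmf_sums[of f B \<nu>, OF f], of "Suc N"] mean
    by (simp add: lessThan_Suc_atMost)
  moreover have "(\<lambda>i. B * pmf \<nu> (i + Suc N)) sums (B * (1 - (\<Sum>i\<le>N. pmf \<nu> i)))"
    using sums_mult[OF sums_split_initial_segment[OF pmf_sums[of \<nu>], of "Suc N"], of B]
    by (simp add: lessThan_Suc_atMost)
  moreover have "norm (pmf \<nu> (j + Suc N) * f (j + Suc N)) \<le> B * pmf \<nu> (j + Suc N)" for j
    using mult_left_mono[OF f, of "pmf \<nu> (j + Suc N)"] by (simp add: abs_mult mult.commute)
  ultimately have "\<bar>- (\<Sum>j\<le>N. pmf \<nu> j * f j)\<bar> \<le> B * (1 - (\<Sum>i\<le>N. pmf \<nu> i))"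
    using norm_sums_le[of "\<lambda>j. pmf \<nu> (j + Suc N) * f (j + Suc N)"] by fastforce
  also have "1 - (\<Sum>i\<le>N. pmf \<nu> i) = lam / (real n - lam) * pmf \<nu> N"
    using tail_eq[of N] N lam_less by (simp add: field_simps)
  finally show ?thesis by simp
qed

text \<open>Summation by parts expresses the variance through partial sums times increments of
  \<open>f\<close>. The weights in the arithmetic-geometric mean step are chosen so that the Hardy
  inequality returns exactly half of the variance; absorbing it on the left leaves the Dirichlet
  form.\<close>

theorem poincare_inequality:
  assumes cert: "gap_certificate n lam \<gamma> \<epsilon>" and \<gamma>: "0 < \<gamma>"
    and f: "\<And>x. \<bar>f x\<bar> \<le> B" and mean: "measure_pmf.expectation \<nu> f = 0"
  shows "\<gamma> * measure_pmf.expectation \<nu> (\<lambda>x. (f x)\<^sup>2)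
    \<le> - measure_pmf.expectation \<nu> (\<lambda>x. f x * mmn_generator n lam f x)"
proof -
  define S where "S k = (\<Sum>j\<le>k. pmf \<nu> j * f j)" for k
  define V where "V N = (\<Sum>j\<le>N. pmf \<nu> j * (f j)\<^sup>2)" for N
  define G where "G N = (\<Sum>j\<le>N. pmf \<nu> j * (f j * mmn_generator n lam f j))" for N
  \<comment> \<open>All sums are cut at \<open>N\<close>; \<open>e N\<close> collects the boundary
    terms of the two summations by parts and of the Hardy inequality. Each is at most a constant
    times \<open>pmf \<nu> N\<close> for \<open>N \<ge> n\<close>, hence vanishes in the
    limit.\<close>
  define e where "e N = \<gamma> * (2 * S N * f N + real n / lam * ((S N)\<^sup>2 / pmf \<nu> N))
      + lam * pmf \<nu> N * (f (Suc N) - f N) * f N" for N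
  have p: "0 < pmf \<nu> j" for j by (rule pmf_pos)
  have B: "0 \<le> B" using f[of 0] by linarith
  have fin: "\<gamma> * V N \<le> - G N + e N" for N
  proof -
    define D where "D = (\<Sum>k<N. pmf \<nu> k * (f (Suc k) - f k)\<^sup>2)"
    define H where "H = (\<Sum>k<N. (S k)\<^sup>2 / pmf \<nu> k)"
    have amgm: "- (S k * (f (Suc k) - f k)) \<le> \<gamma> / (2 * lam) * ((S k)\<^sup>2 / pmf \<nu> k)
        + lam / (2 * \<gamma>) * (pmf \<nu> k * (f (Suc k) - f k)\<^sup>2)" for k
    proof -
      have "\<gamma> / (2 * lam) * ((S k)\<^sup>2 / pmf \<nu> k) + lam / (2 * \<gamma>) * (pmf \<nu> k * (f (Suc k) - f k)\<^sup>2)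
         + S k * (f (Suc k) - f k)
         = (\<gamma> * S k + lam * pmf \<nu> k * (f (Suc k) - f k))\<^sup>2 / (2 * lam * \<gamma> * pmf \<nu> k)"
        using p[of k] \<gamma> lam_pos by (simp add: field_simps power2_eq_square)
      also have "\<dots> \<ge> 0" using p[of k] \<gamma> lam_pos by simp
      finally show ?thesis by simp
    qed
    have "V N = S N * f N + (\<Sum>k<N. - (S k * (f (Suc k) - f k)))"
      unfolding V_def S_def by (subst summation_by_parts_variance) (simp add: sum_negf)
    also have "\<dots> \<le> S N * f N + (\<gamma> / (2 * lam) * H + lam / (2 * \<gamma>) * D)"
      unfolding H_def D_def sum_distrib_left sum.distrib[symmetric]
      by (intro add_left_mono sum_mono amgm)
    finally have 1: "V N \<le> S N * f N + (\<gamma> / (2 * lam) * H + lam / (2 * \<gamma>) * D)" .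
    have "\<gamma> * H \<le> lam * V N + real n * ((S N)\<^sup>2 / pmf \<nu> N)"
      using hardy_inequality[OF cert, where N = N and f = f] by (simp add: H_def V_def S_def)
    then have "\<gamma> / (2 * lam) * H \<le> 1 / (2 * lam) * (lam * V N + real n * ((S N)\<^sup>2 / pmf \<nu> N))"
      using mult_left_mono[of "\<gamma> * H" _ "1 / (2 * lam)"] lam_pos by fastforce
    also have "\<dots> = V N / 2 + real n / (2 * lam) * ((S N)\<^sup>2 / pmf \<nu> N)"
      using lam_pos by (simp add: field_simps)
    finally have "V N / 2 \<le> S N * f N + real n / (2 * lam) * ((S N)\<^sup>2 / pmf \<nu> N) + lam / (2 * \<gamma>) * D"
      using 1 by linarith
    then have "2 * \<gamma> * (V N / 2)
        \<le> 2 * \<gamma> * (S N * f N + real n / (2 * lam) * ((S N)\<^sup>2 / pmf \<nu> N) + lam / (2 * \<gamma>) * D)"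
      using \<gamma> by (intro mult_left_mono) auto
    also have "\<dots> = \<gamma> * (2 * S N * f N + real n / lam * ((S N)\<^sup>2 / pmf \<nu> N)) + lam * D"
      using \<gamma> by (simp add: field_simps)
    also have "lam * D = lam * pmf \<nu> N * (f (Suc N) - f N) * f N - G N"
      unfolding G_def D_def by (subst summation_by_parts_generator) simp
    finally show ?thesis by (simp add: e_def)
  qed
  have f2: "\<bar>(f x)\<^sup>2\<bar> \<le> B\<^sup>2" for x using f[of x] by (simp add: abs_le_square_iff[symmetric] B)
  have gen: "\<bar>mmn_generator n lam f x\<bar> \<le> (lam + real n) * (2 * B)" for x
  proof -
    have "\<bar>lam * (f (Suc x) - f x)\<bar> \<le> lam * (2 * B)"
      using f[of x] f[of "Suc x"] lam_pos by (auto simp: abs_mult)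
    moreover have "\<bar>real (min n x) * (f (x - 1) - f x)\<bar> \<le> real n * (2 * B)"
      unfolding abs_mult using f[of x] f[of "x - 1"] by (intro mult_mono) auto
    ultimately show ?thesis unfolding mmn_generator_def distrib_right by linarith
  qed
  have fg: "\<bar>f x * mmn_generator n lam f x\<bar> \<le> B * ((lam + real n) * (2 * B))" for x
    unfolding abs_mult by (intro mult_mono f gen B) auto
  have V: "V \<longlonglongrightarrow> measure_pmf.expectation \<nu> (\<lambda>x. (f x)\<^sup>2)"
    using expectation_pmf_sums[OF f2, of \<nu>] by (simp add: V_def[abs_def] sums_def_le)
  have G: "G \<longlonglongrightarrow> measure_pmf.expectation \<nu> (\<lambda>x. f x * mmn_generator n lam f x)"
    using expectation_pmf_sums[OF fg, of \<nu>] by (simp add: G_def[abs_def] sums_def_le)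
  have p0: "pmf \<nu> \<longlonglongrightarrow> 0"
    using pmf_sums[of \<nu>] by (intro summable_LIMSEQ_zero) (simp add: sums_iff)
  define K where "K = B * (lam / (real n - lam))"
  define M where "M = \<gamma> * (2 * K * B + real n / lam * K\<^sup>2) + lam * (2 * B) * B"
  have "e \<longlonglongrightarrow> 0"
  proof (rule Lim_null_comparison)
    show "(\<lambda>N. M * pmf \<nu> N) \<longlonglongrightarrow> 0" using tendsto_mult[OF tendsto_const p0, of M] by simp
    show "\<forall>\<^sub>F N in sequentially. norm (e N) \<le> M * pmf \<nu> N"
      using eventually_ge_at_top[of n]
    proof eventually_elim
      case (elim N)
      have S: "\<bar>S N\<bar> \<le> K * pmf \<nu> N"
        using partial_sum_bound[OF f mean elim] by (simp add: S_def K_def)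
      then have "(S N)\<^sup>2 \<le> (K * pmf \<nu> N)\<^sup>2" by (rule abs_le_square_iff[THEN iffD1, OF order_trans[OF _ abs_ge_self]])
      then have "(S N)\<^sup>2 / pmf \<nu> N \<le> (K * pmf \<nu> N)\<^sup>2 / pmf \<nu> N"
        using p[of N] by (simp add: divide_right_mono)
      also have "\<dots> = K\<^sup>2 * pmf \<nu> N" using p[of N] by (simp add: power2_eq_square)
      finally have 2: "\<bar>(S N)\<^sup>2 / pmf \<nu> N\<bar> \<le> K\<^sup>2 * pmf \<nu> N" using p[of N] by simp
      have 1: "\<bar>2 * S N * f N\<bar> \<le> 2 * (K * pmf \<nu> N) * B"
        unfolding abs_mult by (intro mult_mono) (use S f[of N] in auto)
      have "\<bar>f (Suc N) - f N\<bar> \<le> 2 * B" using f[of N] f[of "Suc N"] by linarith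
      then have 3: "\<bar>lam * pmf \<nu> N * (f (Suc N) - f N) * f N\<bar> \<le> lam * pmf \<nu> N * (2 * B) * B"
        unfolding abs_mult using lam_pos p[of N] f[of N] B by (intro mult_mono) auto
      have "\<bar>real n / lam * ((S N)\<^sup>2 / pmf \<nu> N)\<bar> \<le> real n / lam * (K\<^sup>2 * pmf \<nu> N)"
        using 2 lam_pos unfolding abs_mult by (intro mult_mono) auto
      with 1 have "\<bar>\<gamma> * (2 * S N * f N + real n / lam * ((S N)\<^sup>2 / pmf \<nu> N))\<bar>
         \<le> \<gamma> * (2 * (K * pmf \<nu> N) * B + real n / lam * (K\<^sup>2 * pmf \<nu> N))"
        using \<gamma> unfolding abs_mult[of \<gamma>] by (intro mult_mono) linarith+
      with 3 have "\<bar>e N\<bar> \<le> \<gamma> * (2 * (K * pmf \<nu> N) * B + real n / lam * (K\<^sup>2 * pmf \<nu> N))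
          + lam * pmf \<nu> N * (2 * B) * B"
        unfolding e_def by linarith
      also have "\<dots> = M * pmf \<nu> N" by (simp add: M_def algebra_simps)
      finally show ?case by simp
    qed
  qed
  from LIMSEQ_le[OF tendsto_mult[OF tendsto_const V] tendsto_add[OF tendsto_minus[OF G] this]] fin
  show ?thesis by auto
qed

end

section \<open>Convergence to stationarity\<close>

lemma abs_diff_squares_le:
  fixes a b B :: real
  assumes "\<bar>a\<bar> \<le> B" "\<bar>b\<bar> \<le> B"
  shows "\<bar>a\<^sup>2 - b\<^sup>2\<bar> \<le> 2 * B * \<bar>a - b\<bar>"
proof -
  have "\<bar>a\<^sup>2 - b\<^sup>2\<bar> = \<bar>a + b\<bar> * \<bar>a - b\<bar>"
    by (simp add: power2_eq_square abs_mult[symmetric] algebra_simps)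
  also have "\<dots> \<le> 2 * B * \<bar>a - b\<bar>" using assms by (intro mult_right_mono) auto
  finally show ?thesis .
qed

text \<open>As \<open>h\<close> is centred under \<open>\<nu>\<close>, its \<open>\<mu>\<close>-mean
  is the sum of \<open>(pmf \<mu> x - pmf \<nu> x) * h x\<close>. Cauchy-Schwarz with weights
  \<open>sqrt (pmf \<nu> x)\<close> is applied to finite sums, followed by a limit.\<close>

lemma abs_expectation_le_chi:
  fixes h :: "nat \<Rightarrow> real"
  assumes pos: "\<And>x. 0 < pmf \<nu> x" and h: "\<And>x. \<bar>h x\<bar> \<le> B"
    and mean: "measure_pmf.expectation \<nu> h = 0" and fin: "chi_sq \<mu> \<nu> \<noteq> \<infinity>"
  shows "\<bar>measure_pmf.expectation \<mu> h\<bar>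
    \<le> sqrt (measure_pmf.expectation \<nu> (\<lambda>x. (h x)\<^sup>2)) * sqrt (enn2real (chi_sq \<mu> \<nu>))"
proof -
  define c where "c = enn2real (chi_sq \<mu> \<nu>)"
  define V where "V = measure_pmf.expectation \<nu> (\<lambda>x. (h x)\<^sup>2)"
  have B: "0 \<le> B" using h[of 0] by linarith
  have h2: "\<bar>(h x)\<^sup>2\<bar> \<le> B\<^sup>2" for x using h[of x] by (simp add: abs_le_square_iff[symmetric] B)
  have chi: "(\<Sum>x<N. (pmf \<mu> x - pmf \<nu> x)\<^sup>2 / pmf \<nu> x) \<le> c" for N
  proof -
    have "ennreal (\<Sum>x<N. (pmf \<mu> x - pmf \<nu> x)\<^sup>2 / pmf \<nu> x)
        = (\<Sum>x<N. ennreal ((pmf \<mu> x - pmf \<nu> x)\<^sup>2) / ennreal (pmf \<nu> x))"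
      by (subst sum_ennreal[symmetric]) (auto simp: divide_ennreal pos)
    also have "\<dots> \<le> chi_sq \<mu> \<nu>"
      unfolding chi_sq_def nn_integral_count_space_nat by (rule sum_le_suminf) auto
    also have "chi_sq \<mu> \<nu> = ennreal c"
      using fin by (simp add: c_def ennreal_enn2real less_top)
    finally show ?thesis by (simp add: c_def)
  qed
  have var: "(\<Sum>x<N. pmf \<nu> x * (h x)\<^sup>2) \<le> V" for N
  proof -
    have "(\<lambda>x. pmf \<nu> x * (h x)\<^sup>2) sums V"
      unfolding V_def by (rule expectation_pmf_sums[OF h2])
    then show ?thesis
      by (auto simp: sums_iff intro!: sum_le_suminf)
  qed
  have "(\<lambda>x. pmf \<mu> x * h x - pmf \<nu> x * h x) sums
      (measure_pmf.expectation \<mu> h - measure_pmf.expectation \<nu> h)"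
    by (intro sums_diff expectation_pmf_sums[of h B, OF h])
  then have "(\<lambda>N. \<Sum>x<N. pmf \<mu> x * h x - pmf \<nu> x * h x) \<longlonglongrightarrow> measure_pmf.expectation \<mu> h"
    by (simp add: sums_def mean)
  then have lim: "(\<lambda>N. (\<Sum>x<N. pmf \<mu> x * h x - pmf \<nu> x * h x)\<^sup>2) \<longlonglongrightarrow> (measure_pmf.expectation \<mu> h)\<^sup>2"
    by (intro tendsto_intros)
  have cs: "(\<Sum>x<N. pmf \<mu> x * h x - pmf \<nu> x * h x)\<^sup>2 \<le> V * c" for N
  proof -
    have e: "pmf \<mu> x * h x - pmf \<nu> x * h x
        = ((pmf \<mu> x - pmf \<nu> x) / sqrt (pmf \<nu> x)) * (sqrt (pmf \<nu> x) * h x)" for x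
      using pos[of x] by (simp add: left_diff_distrib[symmetric])
    have "(\<Sum>x<N. pmf \<mu> x * h x - pmf \<nu> x * h x)\<^sup>2
      \<le> (\<Sum>x<N. ((pmf \<mu> x - pmf \<nu> x) / sqrt (pmf \<nu> x))\<^sup>2) * (\<Sum>x<N. (sqrt (pmf \<nu> x) * h x)\<^sup>2)"
      unfolding e by (rule Cauchy_Schwarz_ineq_sum)
    also have "\<dots> = (\<Sum>x<N. (pmf \<mu> x - pmf \<nu> x)\<^sup>2 / pmf \<nu> x) * (\<Sum>x<N. pmf \<nu> x * (h x)\<^sup>2)"
      by (simp add: power_divide power_mult_distrib)
    also have "\<dots> \<le> c * V"
      by (intro mult_mono chi var) (auto simp: c_def intro!: sum_nonneg)
    finally show ?thesis by (simp add: mult.commute)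
  qed
  have "(measure_pmf.expectation \<mu> h)\<^sup>2 \<le> V * c"
    by (rule LIMSEQ_le_const2[OF lim]) (use cs in auto)
  then have "\<bar>measure_pmf.expectation \<mu> h\<bar> \<le> sqrt (V * c)"
    by (metis real_sqrt_abs real_sqrt_le_mono)
  then show ?thesis by (simp add: real_sqrt_mult V_def c_def)
qed

context mmn_queue
begin

text \<open>Stationarity keeps the evolved function centred, so the Poincare inequality applies at
  every time, and \<open>exp (2 * \<gamma> * s)\<close> times the variance has nonpositive right
  derivative.\<close>

theorem variance_decay:
  assumes cert: "gap_certificate n lam \<gamma> \<epsilon>" and \<gamma>: "0 < \<gamma>"
    and f: "\<And>x. \<bar>f x\<bar> \<le> B" and mean: "measure_pmf.expectation \<nu> f = 0" and t: "0 \<le> t"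
  shows "measure_pmf.expectation \<nu> (\<lambda>x. (transition_op P t f x)\<^sup>2)
    \<le> exp (- 2 * \<gamma> * t) * measure_pmf.expectation \<nu> (\<lambda>x. (f x)\<^sup>2)"
proof -
  define F where "F s = measure_pmf.expectation \<nu> (\<lambda>x. (transition_op P s f x)\<^sup>2)" for s
  define F' where "F' s = measure_pmf.expectation \<nu>
      (\<lambda>x. 2 * (transition_op P s f x * mmn_generator n lam (transition_op P s f) x))" for s
  define K where "K = 2 * B * (2 * B * (lam + real n))"
  have B: "0 \<le> B" using f[of 0] by linarith
  have bd: "\<bar>transition_op P s f x\<bar> \<le> B" for s x by (rule abs_transition_op_le[of f, OF f])
  have bd2: "\<bar>(transition_op P s f x)\<^sup>2\<bar> \<le> B\<^sup>2" for s x
    using bd[of s x] by (simp add: abs_le_square_iff[symmetric] B)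
  have lip: "\<bar>(transition_op P s f x)\<^sup>2 - (transition_op P r f x)\<^sup>2\<bar> \<le> K * (s - r)"
    if "0 \<le> r" "r \<le> s" for r s x
  proof -
    have "\<bar>(transition_op P s f x)\<^sup>2 - (transition_op P r f x)\<^sup>2\<bar>
        \<le> 2 * B * \<bar>transition_op P s f x - transition_op P r f x\<bar>"
      by (rule abs_diff_squares_le[OF bd bd])
    also have "\<dots> \<le> 2 * B * (2 * B * (lam + real n) * (s - r))"
      using B by (intro mult_left_mono transition_op_diff_le_mmn that f) auto
    finally show ?thesis by (simp add: K_def mult.assoc)
  qed
  have der: "(F has_real_derivative F' s) (at s within {s..})" if "0 \<le> s" for s
    unfolding F_def F'_def
  proof (rule has_right_derivative_expectation[where B = "B\<^sup>2" and K = K])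
    fix x
    have "((\<lambda>s. transition_op P s f x * transition_op P s f x) has_real_derivative
       mmn_generator n lam (transition_op P s f) x * transition_op P s f x
       + mmn_generator n lam (transition_op P s f) x * transition_op P s f x) (at s within {s..})"
      by (intro DERIV_mult has_right_derivative_mmn[of _ f, OF _ f] that)
    then show "((\<lambda>s. (transition_op P s f x)\<^sup>2) has_real_derivative
      2 * (transition_op P s f x * mmn_generator n lam (transition_op P s f) x)) (at s within {s..})"
      by (simp add: power2_eq_square mult.commute)
  qed (use lip that bd2 in auto)
  have F': "F' s \<le> - 2 * \<gamma> * F s" if "0 \<le> s" for s
    using poincare_inequality[OF cert \<gamma>, of "transition_op P s f" B]
      bd expectation_transition_op_stationary[of s f B] that f mean
    by (simp add: F_def F'_def)
  have lipF: "\<bar>F s - F r\<bar> \<le> K * (s - r)" if "0 \<le> r" "r \<le> s" for r s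
  proof -
    have "F s - F r = measure_pmf.expectation \<nu> (\<lambda>x. (transition_op P s f x)\<^sup>2 - (transition_op P r f x)\<^sup>2)"
      unfolding F_def by (subst Bochner_Integration.integral_diff)
        (auto intro!: integrable_pmf_bounded[where B = "B\<^sup>2"] simp: bd2[simplified])
    then show ?thesis using abs_expectation_pmf_le[OF lip[OF that]] by simp
  qed
  have K: "0 \<le> K" using B lam_pos by (simp add: K_def)
  \<comment> \<open>One-sided derivatives do not give continuity from the left; the Lipschitz bound
    does.\<close>
  have "K-lipschitz_on {0..t} F"
  proof (rule lipschitz_onI[OF _ K])
    fix r s assume "r \<in> {0..t}" "s \<in> {0..t}"
    then show "dist (F r) (F s) \<le> K * dist r s"
      using lipF[of r s] lipF[of s r] by (cases "r \<le> s") (auto simp: dist_real_def abs_minus_commute)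
  qed
  then have cont: "continuous_on {0..t} F" by (rule lipschitz_on_continuous_on)
  define G where "G s = exp (2 * \<gamma> * s) * F s" for s
  have "G t \<le> G 0"
  proof (rule nonincreasing_of_right_derivative[OF t])
    show "continuous_on {0..t} G" unfolding G_def by (intro continuous_intros cont)
    fix s assume s: "0 \<le> s" "s < t"
    show "(G has_real_derivative exp (2 * \<gamma> * s) * (2 * \<gamma> * F s + F' s)) (at s within {s..})"
      unfolding G_def by (rule derivative_eq_intros der s refl | simp add: algebra_simps)+
    show "exp (2 * \<gamma> * s) * (2 * \<gamma> * F s + F' s) \<le> 0"
      using F'[OF s(1)] by (intro mult_nonneg_nonpos) auto
  qed
  then have "exp (- 2 * \<gamma> * t) * (exp (2 * \<gamma> * t) * F t) \<le> exp (- 2 * \<gamma> * t) * F 0"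
    by (intro mult_left_mono) (simp_all add: G_def)
  then have "F t \<le> exp (- 2 * \<gamma> * t) * F 0"
    unfolding mult.assoc[symmetric] exp_add[symmetric] by simp
  then show ?thesis by (simp add: F_def transition_op_0[OF ctmc])
qed

text \<open>The centred indicator has variance \<open>a * (1 - a)\<close>. Keeping this factor is
  what later produces the small prefactor \<open>sqrt y\<close> in the upper bound.\<close>

theorem mixing_bound:
  assumes cert: "gap_certificate n lam \<gamma> \<epsilon>" and \<gamma>: "0 < \<gamma>" and t: "0 \<le> t"
    and fin: "chi_sq \<mu> \<nu> \<noteq> \<infinity>"
  shows "\<bar>measure_pmf.prob (law_at P \<mu> t) A - measure_pmf.prob \<nu> A\<bar>
    \<le> sqrt (measure_pmf.prob \<nu> A * (1 - measure_pmf.prob \<nu> A)) * exp (- \<gamma> * t)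
        * sqrt (enn2real (chi_sq \<mu> \<nu>))"
proof -
  define a where "a = measure_pmf.prob \<nu> A"
  define f where "f x = indicator A x - a" for x
  have a: "0 \<le> a" "a \<le> 1" by (auto simp: a_def)
  have f: "\<bar>f x\<bar> \<le> 1" for x using a by (auto simp: f_def split: split_indicator)
  have ia: "integrable (measure_pmf p) (indicator A :: nat \<Rightarrow> real)" for p
    by (rule integrable_pmf_bounded[where B = 1]) (auto split: split_indicator)
  have ef: "measure_pmf.expectation p f = measure_pmf.prob p A - a" for p
    unfolding f_def by (subst Bochner_Integration.integral_diff[OF ia]) auto
  have mean: "measure_pmf.expectation \<nu> f = 0" by (simp add: ef a_def)
  have f2: "(\<lambda>x. (f x)\<^sup>2) = (\<lambda>x. (1 - 2 * a) * indicator A x + a\<^sup>2)"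
    by (auto simp: f_def power2_eq_square algebra_simps split: split_indicator)
  have "measure_pmf.expectation \<nu> (\<lambda>x. (f x)\<^sup>2) = (1 - 2 * a) * a + a\<^sup>2"
    unfolding f2 by (subst Bochner_Integration.integral_add) (auto simp: ia a_def)
  then have var: "measure_pmf.expectation \<nu> (\<lambda>x. (f x)\<^sup>2) = a * (1 - a)"
    by (simp add: power2_eq_square algebra_simps)
  have "\<bar>measure_pmf.expectation \<mu> (transition_op P t f)\<bar>
    \<le> sqrt (measure_pmf.expectation \<nu> (\<lambda>x. (transition_op P t f x)\<^sup>2)) * sqrt (enn2real (chi_sq \<mu> \<nu>))"
    by (rule abs_expectation_le_chi[OF pmf_pos _ _ fin, where B = 1])
       (auto intro: abs_transition_op_le[of f, OF f]
         simp: expectation_transition_op_stationary[OF t f] mean)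
  also have "\<dots> \<le> sqrt (exp (- 2 * \<gamma> * t) * (a * (1 - a))) * sqrt (enn2real (chi_sq \<mu> \<nu>))"
    using variance_decay[OF cert \<gamma> f mean t] unfolding var
    by (intro mult_right_mono) auto
  also have "exp (- 2 * \<gamma> * t) = (exp (- \<gamma> * t))\<^sup>2"
    by (simp add: power2_eq_square exp_add[symmetric])
  also have "sqrt ((exp (- \<gamma> * t))\<^sup>2 * (a * (1 - a))) = sqrt (a * (1 - a)) * exp (- \<gamma> * t)"
    by (simp add: real_sqrt_mult)
  finally show ?thesis
    by (simp add: expectation_transition_op[OF t f] ef a_def)
qed

end

section \<open>Supersolutions for the increment chain\<close>

text \<open>At and above \<open>n\<close> the optimal constant ratio gives equality. Below
  \<open>n\<close> the death term only helps; after dropping it, cost plus rate is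
  \<open>s * (s - l)\<close>, at most \<open>s^2 - l^2 = n - lam \<le> 1\<close>.\<close>

lemma gap_certificate_sqrt:
  assumes "0 < lam" "lam \<le> real n" "real n - lam \<le> 1"
  shows "gap_certificate n lam ((sqrt (real n) - sqrt lam)\<^sup>2) (\<lambda>_. sqrt (real n) / sqrt lam - 1)"
proof -
  define s l where "s = sqrt (real n)" and "l = sqrt lam"
  have l: "0 < l" "l \<le> s" "0 < s" using assms by (auto simp: s_def l_def)
  have sq: "s\<^sup>2 = real n" "l\<^sup>2 = lam" using assms by (simp_all add: s_def l_def)
  have e: "(s / l - 1) / (1 + (s / l - 1)) = (s - l) / s" "l\<^sup>2 * (s / l - 1) = l * (s - l)"
    using l by (simp_all add: field_simps power2_eq_square)
  have "s * (s - l) \<le> s\<^sup>2 - l\<^sup>2"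
    using l by (simp add: power2_eq_square algebra_simps)
  then have small: "s * (s - l) \<le> 1" using assms sq by simp
  show ?thesis
    unfolding gap_certificate_def s_def[symmetric] l_def[symmetric]
  proof (intro conjI allI)
    show "0 \<le> s / l - 1" using l by simp
    fix x
    show "lam * (s / l - 1) - real (min n x) * ((s / l - 1) / (1 + (s / l - 1)))
        \<le> (if x < n then 1 else 0) - (s - l)\<^sup>2"
    proof (cases "x < n")
      case True
      have "0 \<le> real (min n x) * ((s - l) / s)" using l by simp
      moreover have "l * (s - l) + (s - l)\<^sup>2 = s * (s - l)"
        by (simp add: power2_eq_square algebra_simps)
      ultimately show ?thesis using True small unfolding e sq(2)[symmetric] by simp
    next
      case False
      then have "real (min n x) * ((s - l) / s) = s * (s - l)"
        using l by (simp add: min_def sq(1)[symmetric] power2_eq_square)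
      then show ?thesis using False unfolding e sq(2)[symmetric]
        by (simp add: power2_eq_square algebra_simps)
    qed
  qed
qed

text \<open>A crude certificate for the parameters that the sharp ones miss:
  \<open>e < n / lam - 1\<close> gives a gain in the states \<open>x \<ge> n\<close>, and
  \<open>e \<le> 1 / (2 * lam)\<close> keeps the cost below \<open>n\<close> at most 1/2.\<close>

lemma ex_gap_certificate:
  assumes lam: "0 < lam" "lam < real n"
  shows "\<exists>\<gamma> \<epsilon>. 0 < \<gamma> \<and> gap_certificate n lam \<gamma> \<epsilon>"
proof -
  define e where "e = min (1 / (2 * lam)) ((real n / lam - 1) / 2)"
  have e: "0 < e" using lam by (simp add: e_def)
  have "lam * e \<le> lam * (1 / (2 * lam))"
    using lam by (intro mult_left_mono) (auto simp: e_def)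
  then have e1: "lam * e \<le> 1 / 2" using lam by simp
  define r where "r = real n / lam"
  have "1 < r" using lam by (simp add: r_def)
  then have "(r - 1) / 2 < r - 1" by simp
  moreover have "e \<le> (r - 1) / 2" unfolding e_def r_def by (rule min.cobounded2)
  ultimately have "e < r - 1" by linarith
  then have "lam < real n / (1 + e)" using lam e by (simp add: r_def field_simps)
  then have "lam * e < real n / (1 + e) * e" using e by (intro mult_strict_right_mono)
  then have e2: "lam * e < real n * (e / (1 + e))" by simp
  define g where "g = min (1 / 2) (real n * (e / (1 + e)) - lam * e)"
  have "0 < g" using e2 by (simp add: g_def)
  moreover have "gap_certificate n lam g (\<lambda>_. e)"
    unfolding gap_certificate_def
  proof (intro conjI allI)
    show "0 \<le> e" using e by simp
    fix x
    show "lam * e - real (min n x) * (e / (1 + e)) \<le> (if x < n then 1 else 0) - g"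
    proof (cases "x < n")
      case True
      have "0 \<le> real (min n x) * (e / (1 + e))" using e by simp
      moreover have "g \<le> 1 / 2" unfolding g_def by (rule min.cobounded1)
      ultimately show ?thesis using True e1 by simp
    next
      case False
      moreover have "g \<le> real n * (e / (1 + e)) - lam * e" unfolding g_def by (rule min.cobounded2)
      ultimately show ?thesis by (simp add: min_def)
    qed
  qed
  ultimately show ?thesis by blast
qed

text \<open>The full value 1 is reached at \<open>n - 1\<close> rather than \<open>n\<close>,
  because at \<open>x = n\<close> the certificate also involves the index
  \<open>x - 1\<close>.\<close>

definition ramp :: "nat \<Rightarrow> nat \<Rightarrow> real" where
  "ramp n x = max 0 (min 1 (1 - (real n - 1 - real x) / sqrt (real n)))"

text \<open>Below \<open>n\<close> both \<open>(n - x) * ramp n x\<close> and \<open>x\<close> times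
  the increment of the ramp are at most \<open>sqrt n\<close>; these are the two copies of
  \<open>sqrt n * e\<close> in \<open>inner\<close>. From \<open>n\<close> on the ramp equals 1 and
  the condition is \<open>outer\<close>.\<close>

lemma gap_certificate_ramp:
  assumes n: "0 < n" and lam: "0 < lam" "lam \<le> real n" and e: "0 \<le> e"
    and inner: "2 * sqrt (real n) * e + real n * e\<^sup>2 \<le> 1 - \<gamma>"
    and outer: "lam * e - real n * (e / (1 + e)) \<le> - \<gamma>"
  shows "gap_certificate n lam \<gamma> (\<lambda>x. e * ramp n x)"
  unfolding gap_certificate_def
proof (intro conjI allI)
  define s where "s = sqrt (real n)"
  have s: "1 \<le> s" "s * s = real n" using n by (auto simp: s_def)
  have ramp: "0 \<le> ramp n x" "ramp n x \<le> 1" for x by (auto simp: ramp_def)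
  show "0 \<le> e * ramp n x" for x using e ramp by simp
  fix x
  define b where "b = e * ramp n (x - 1)"
  have b: "0 \<le> b" "b \<le> e" using e ramp[of "x - 1"] by (auto simp: b_def mult_left_le)
  show "lam * (e * ramp n x) - real (min n x) * (e * ramp n (x - 1) / (1 + e * ramp n (x - 1)))
      \<le> (if x < n then 1 else 0) - \<gamma>"
  proof (cases "x < n")
    case False
    have "ramp n y = 1" if "n - 1 \<le> y" for y
    proof -
      have "(real n - 1 - real y) / sqrt (real n) \<le> 0" using that n by (intro divide_nonpos_pos) auto
      then show ?thesis by (simp add: ramp_def)
    qed
    from this[of x] this[of "x - 1"] False outer show ?thesis by (simp add: min_def)
  next
    case True
    define m where "m = real n - 1 - real x"
    have m: "0 \<le> m" using True by (simp add: m_def)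
    have rampx: "ramp n x = max 0 (1 - m / s)"
      using m s(1) by (simp add: ramp_def m_def[symmetric] s_def[symmetric])
    have "(m + 1) * (1 - m / s) \<le> s"
    proof -
      have "(m + 1) * (s - m) \<le> s * s"
      proof -
        \<comment> \<open>Completing the square at the maximum \<open>m = (s - 1) / 2\<close>; then
          \<open>1 \<le> s\<close> gives \<open>(s + 1) / 2 \<le> s\<close>.\<close>
        have "(m + 1) * (s - m) = ((s + 1) / 2)\<^sup>2 - (m - (s - 1) / 2)\<^sup>2"
          by (simp add: power2_eq_square field_simps)
        also have "\<dots> \<le> ((s + 1) / 2)\<^sup>2" by simp
        also have "\<dots> \<le> s\<^sup>2" using s(1) by (intro power_mono) auto
        finally show ?thesis by (simp add: power2_eq_square)
      qed
      then show ?thesis using s(1) by (simp add: field_simps)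
    qed
    then have 1: "(real n - real x) * ramp n x \<le> s"
    proof -
      have "real n - real x = m + 1" by (simp add: m_def)
      moreover have "(m + 1) * ramp n x \<le> s"
        using \<open>(m + 1) * (1 - m / s) \<le> s\<close> s(1) unfolding rampx by (cases "1 - m / s \<le> 0") auto
      ultimately show ?thesis by simp
    qed
    have 2: "real x * (ramp n x - ramp n (x - 1)) \<le> s"
    proof (cases x)
      case (Suc y)
      have lip: "max 0 (min 1 (1 - (a - h))) - max 0 (min 1 (1 - a)) \<le> h" if "0 < h" for a h :: real
        using that by (auto simp: max_def min_def)
      have "(real n - 1 - real x) / s = (real n - 1 - real y) / s - 1 / s"
        using Suc by (simp add: diff_divide_distrib add_divide_distrib)
      with lip[of "1 / s" "(real n - 1 - real y) / s"] have "ramp n x - ramp n (x - 1) \<le> 1 / s"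
        using s(1) unfolding ramp_def s_def[symmetric] Suc by simp
      then have "real x * (ramp n x - ramp n (x - 1)) \<le> real n * (1 / s)"
        using True s(1) by (intro order_trans[OF mult_left_mono mult_right_mono]) auto
      also have "\<dots> = s" using s by (simp add: field_simps)
      finally show ?thesis .
    qed (use s in simp)
    \<comment> \<open>Linearising \<open>b / (1 + b)\<close> costs at most \<open>e^2\<close> per
      unit of death rate, whence the term \<open>n * e^2\<close> in \<open>inner\<close>.\<close>
    have "b - e\<^sup>2 \<le> b - b\<^sup>2" using b by (simp add: power_mono)
    also have "\<dots> \<le> b / (1 + b)"
    proof -
      have "(b - b\<^sup>2) * (1 + b) \<le> b" using b by (simp add: power2_eq_square algebra_simps)
      then show ?thesis using b by (simp add: pos_le_divide_eq)
    qed
    finally have "real x * (b - e\<^sup>2) \<le> real x * (b / (1 + b))" by (intro mult_left_mono) auto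
    moreover have "real x * e\<^sup>2 \<le> real n * e\<^sup>2" using True by (intro mult_right_mono) auto
    moreover have "lam * (e * ramp n x) \<le> real n * (e * ramp n x)"
      using lam e ramp by (intro mult_right_mono) auto
    ultimately have "lam * (e * ramp n x) - real x * (b / (1 + b))
       \<le> real n * (e * ramp n x) - real x * b + real n * e\<^sup>2"
      by (simp add: right_diff_distrib)
    also have "\<dots> = e * ((real n - real x) * ramp n x) + e * (real x * (ramp n x - ramp n (x - 1))) + real n * e\<^sup>2"
      by (simp add: b_def algebra_simps)
    also have "\<dots> \<le> e * s + e * s + real n * e\<^sup>2"
      by (intro add_mono mult_left_mono 1 2 e) auto
    also have "\<dots> \<le> 1 - \<gamma>" using inner unfolding s_def[symmetric] by (simp add: mult_ac)
    finally show ?thesis using True by (simp add: b_def)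
  qed
qed

text \<open>The optimal ratio makes the outer condition an equality. From
  \<open>s - l \<le> y\<close> and \<open>s * e \<le> 2 * y\<close>, the inner cost plus the rate is
  at most \<open>4 * y + 5 * y^2\<close>, below 1 when \<open>y \<le> 1 / 10\<close>.\<close>

lemma gap_certificate_small_slack:
  assumes n: "0 < n" and y: "0 \<le> y" "y \<le> 1 / 10" and lam: "lam = real n - sqrt (real n) * y"
  shows "gap_certificate n lam ((sqrt (real n) - sqrt lam)\<^sup>2)
    (\<lambda>x. (sqrt (real n) / sqrt lam - 1) * ramp n x)"
proof -
  define s l where "s = sqrt (real n)" and "l = sqrt lam"
  have s: "1 \<le> s" "s\<^sup>2 = real n" using n by (auto simp: s_def)
  have "s * y \<le> s\<^sup>2 / 2"
    using s y mult_left_mono[of y "s / 2" s] by (simp add: power2_eq_square)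
  then have lam_ge: "s\<^sup>2 / 2 \<le> lam" using s by (simp add: lam s_def[symmetric])
  then have lam0: "0 < lam" using s n by simp
  have lamle: "lam \<le> real n" using y by (simp add: lam)
  have l: "0 < l" "l \<le> s" "l\<^sup>2 = lam" using lam0 lamle by (auto simp: l_def s_def)
  define e where "e = s / l - 1"
  have e0: "0 \<le> e" using l by (simp add: e_def)
  have diff: "s - l \<le> y"
  proof -
    have "s * (s - l) \<le> (s + l) * (s - l)" using l by (intro mult_right_mono) auto
    also have "\<dots> = s * y" using s l lam by (simp add: power2_eq_square algebra_simps s_def[symmetric])
    finally show ?thesis using s by simp
  qed
  have "s \<le> 2 * l"
  proof -
    have "s\<^sup>2 \<le> (2 * l)\<^sup>2" using lam_ge l lam0 by (simp add: power_mult_distrib)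
    then show ?thesis by (rule power2_le_imp_le) (use l in simp)
  qed
  have "s * e = s * (s - l) / l" using l by (simp add: e_def field_simps)
  also have "\<dots> \<le> 2 * y"
  proof -
    have "s * (s - l) \<le> (2 * l) * y" using \<open>s \<le> 2 * l\<close> diff l s by (intro mult_mono) auto
    then show ?thesis using l by (simp add: field_simps)
  qed
  finally have se: "s * e \<le> 2 * y" .
  then have "(s * e)\<^sup>2 \<le> (2 * y)\<^sup>2" using s e0 by (intro power_mono) auto
  then have ne: "real n * e\<^sup>2 \<le> (2 * y)\<^sup>2" using s by (simp add: power_mult_distrib)
  have d2: "(s - l)\<^sup>2 \<le> y\<^sup>2" using diff l by (intro power_mono) auto
  have y2: "y\<^sup>2 \<le> (1 / 10)\<^sup>2" using y by (intro power_mono) auto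
  have "gap_certificate n lam ((s - l)\<^sup>2) (\<lambda>x. e * ramp n x)"
  proof (rule gap_certificate_ramp[OF n lam0 lamle e0])
    show "2 * sqrt (real n) * e + real n * e\<^sup>2 \<le> 1 - (s - l)\<^sup>2"
      using se ne d2 y2 y unfolding s_def[symmetric] by (simp add: power2_eq_square)
    have "lam * e = l * (s - l)" using l(1) unfolding l(3)[symmetric]
      by (simp add: e_def field_simps power2_eq_square)
    moreover have "real n * (e / (1 + e)) = s * (s - l)"
      using l(1) s(1) unfolding s(2)[symmetric] by (simp add: e_def field_simps power2_eq_square)
    ultimately show "lam * e - real n * (e / (1 + e)) \<le> - ((s - l)\<^sup>2)"
      by (simp add: power2_eq_square algebra_simps)
  qed
  then show ?thesis by (simp add: e_def s_def l_def)
qed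

text \<open>The inner cost is \<open>1/2 + 1/16\<close>, and the outer gain is at least
  \<open>y / 4 - 1 / 16 \<ge> 3 / 16\<close>, so both conditions leave room for the rate
  1/25.\<close>

lemma gap_certificate_large_slack:
  assumes n: "0 < n" and y: "1 \<le> y" and lam: "lam = real n - sqrt (real n) * y" "0 < lam"
  shows "gap_certificate n lam (1 / 25) (\<lambda>x. 1 / (4 * sqrt (real n)) * ramp n x)"
proof (rule gap_certificate_ramp[OF n lam(2)])
  define s where "s = sqrt (real n)"
  have s: "1 \<le> s" "s\<^sup>2 = real n" using n by (auto simp: s_def)
  define e where "e = 1 / (4 * s)"
  have e: "0 < e" "s * e = 1 / 4" using s by (auto simp: e_def)
  show "lam \<le> real n" using y by (simp add: lam)
  show "0 \<le> 1 / (4 * sqrt (real n))" by simp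
  have "real n * e\<^sup>2 = (s * e)\<^sup>2" using s by (simp add: power_mult_distrib)
  then have ne: "real n * e\<^sup>2 = 1 / 16" by (simp add: e(2) power2_eq_square)
  then show "2 * sqrt (real n) * (1 / (4 * sqrt (real n))) + real n * (1 / (4 * sqrt (real n)))\<^sup>2 \<le> 1 - 1 / 25"
    using e unfolding s_def[symmetric] e_def[symmetric] by simp
  have "e - e\<^sup>2 \<le> e / (1 + e)"
  proof -
    have "(e - e\<^sup>2) * (1 + e) \<le> e" using e by (simp add: power2_eq_square algebra_simps)
    then show ?thesis using e by (simp add: pos_le_divide_eq)
  qed
  then have "real n * (e - e\<^sup>2) \<le> real n * (e / (1 + e))" by (intro mult_left_mono) auto
  then have "lam * e - real n * (e / (1 + e)) \<le> real n * e\<^sup>2 - (s * e) * y"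
    by (simp add: lam s_def[symmetric] algebra_simps)
  also have "\<dots> \<le> - (1 / 25)" using y by (simp add: e ne)
  finally show "lam * (1 / (4 * sqrt (real n))) - real n * (1 / (4 * sqrt (real n)) / (1 + 1 / (4 * sqrt (real n)))) \<le> - (1 / 25)"
    unfolding s_def[symmetric] e_def[symmetric] .
qed

section \<open>The stationary distribution below \<open>n\<close>\<close>

lemma one_minus_ge_exp:
  fixes u :: real
  assumes "0 \<le> u" "u \<le> 1 / 2"
  shows "exp (- (2 * u)) \<le> 1 - u"
proof -
  have "2 * u\<^sup>2 \<le> u" using assms mult_right_mono[of u "1/2" u] by (simp add: power2_eq_square)
  then have "- (2 * u) \<le> ln (1 - u)" using ln_one_minus_pos_lower_bound[OF assms] by simp
  then show ?thesis using assms by (simp add: ln_ge_iff)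
qed

lemma sum_real_lessThan: "(\<Sum>i<j. real i) = real j * (real j - 1) / 2"
  by (induction j) (simp_all add: field_simps)

lemma exp_quotient:
  fixes c :: real
  shows "c \<noteq> 0 \<Longrightarrow> c * exp (- a) / (c * exp (- b)) = exp (b - a)"
  by (simp add: exp_diff exp_minus field_simps)

context mmn_queue
begin

text \<open>The quotient \<open>pmf \<nu> (n - j) / pmf \<nu> n\<close> for
  \<open>j \<le> n\<close>; on the scale \<open>j ~ sqrt n\<close> it behaves like the Gaussian
  profile \<open>exp (j * y / sqrt n - j^2 / (2 * n))\<close>.\<close>

definition ratio :: "nat \<Rightarrow> real" where
  "ratio j = (\<Prod>i<j. (real n - real i) / lam)"

lemma ratio_nonneg: "j \<le> n \<Longrightarrow> 0 \<le> ratio j"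
  using lam_pos unfolding ratio_def by (intro prod_nonneg) auto

lemma pmf_below: "j \<le> n \<Longrightarrow> pmf \<nu> (n - j) = ratio j * pmf \<nu> n"
proof (induction j)
  case (Suc j)
  then have "real (n - j) * pmf \<nu> (n - j) = lam * pmf \<nu> (n - Suc j)"
    using detailed_balance[of "n - Suc j"] by (simp add: Suc_diff_Suc)
  then have "pmf \<nu> (n - Suc j) = (real n - real j) / lam * pmf \<nu> (n - j)"
    using lam_pos Suc.prems by (simp add: field_simps of_nat_diff)
  with Suc show ?case by (simp add: ratio_def mult.commute mult.left_commute)
qed (simp add: ratio_def)

text \<open>The busy probability is tied to \<open>pmf \<nu> n\<close> by the geometric tail, the
  idle one by the ratios. Eliminating \<open>pmf \<nu> n\<close> removes the normalising constant,
  so bounds on the ratio sum alone decide both regimes.\<close>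

lemma idle_balance:
  "real n * measure_pmf.prob \<nu> {..<n}
     = (real n - lam) * (1 - measure_pmf.prob \<nu> {..<n}) * (\<Sum>j<n. ratio (Suc j))"
proof -
  obtain m where m: "n = Suc m" using n_pos by (cases n) auto
  have a: "measure_pmf.prob \<nu> {..<n} = (\<Sum>i<n. pmf \<nu> i)"
    by (simp add: measure_measure_pmf_finite)
  have "real n * pmf \<nu> n = lam * pmf \<nu> m" using detailed_balance[of m] by (simp add: m)
  then have 1: "(real n - lam) * (1 - measure_pmf.prob \<nu> {..<n}) = real n * pmf \<nu> n"
    using tail_eq[of m] unfolding a by (simp add: m lessThan_Suc_atMost)
  have "(\<Sum>i<n. pmf \<nu> i) = (\<Sum>j<n. pmf \<nu> (n - Suc j))"
    by (rule sum.nat_diff_reindex[symmetric])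
  also have "\<dots> = (\<Sum>j<n. ratio (Suc j)) * pmf \<nu> n"
    by (auto simp: sum_distrib_right intro!: sum.cong pmf_below)
  finally show ?thesis unfolding 1 unfolding a by simp
qed

text \<open>For small \<open>y\<close> the quadratic decay of \<open>ratio\<close> beats its linear
  growth, so the ratio sum is of order \<open>sqrt n\<close> and the idle probability of order
  \<open>y\<close>. The argument gives the constant \<open>10 / 3 * exp 1\<close>, which is below
  \<open>4 * pi * exp 1\<close>.\<close>

lemma prob_idle_le:
  assumes y: "0 \<le> y" and lam: "lam = real n - sqrt (real n) * y"
  shows "measure_pmf.prob \<nu> {..<n} \<le> 4 * exp 1 * pi * y"
proof (cases "y \<le> 1 / 10")
  case False
  \<comment> \<open>For \<open>y > 1 / 10\<close> the claimed bound already exceeds 1.\<close>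
  have "(4 :: real) * 2 * 3 * (1 / 10) \<le> 4 * exp 1 * pi * y"
    using False pi_gt3 exp_ge_add_one_self[of "1::real"] by (intro mult_mono) auto
  then show ?thesis using measure_pmf.prob_le_1[of \<nu> "{..<n}"] by linarith
next
  case True
  define s where "s = sqrt (real n)"
  have s: "1 \<le> s" "s * s = real n" using n_pos by (auto simp: s_def)
  define W where "W = (\<Sum>j<n. ratio (Suc j))"
  define q where "q = exp (- (3 / (10 * s)))"
  have ratio_le: "ratio j \<le> exp 1 * q ^ j" if "j \<le> n" for j
  proof -
    have f: "(real n - real i) / lam \<le> exp (2 * y / s - real i / real n)" if "i < n" for i
    proof -
      have u: "y / s \<le> 1 / 2" using True y s(1) frac_le[of "1/2" y 1 s] by simp
      have "lam = real n * (1 - y / s)"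
        using s by (simp add: lam s_def[symmetric] s(2)[symmetric] field_simps)
      moreover have "exp (- (2 * (y / s))) \<le> 1 - y / s"
        using y s u by (intro one_minus_ge_exp) auto
      ultimately have "real n * exp (- (2 * (y / s))) \<le> lam"
        using mult_left_mono[of "exp (- (2 * (y / s)))" "1 - y / s" "real n"] by simp
      moreover have "real n - real i \<le> real n * exp (- (real i / real n))"
      proof -
        have "1 - real i / real n \<le> exp (- (real i / real n))"
          using exp_ge_add_one_self[of "- (real i / real n)"] by simp
        then have "real n * (1 - real i / real n) \<le> real n * exp (- (real i / real n))"
          by (intro mult_left_mono) auto
        then show ?thesis using n_pos by (simp add: right_diff_distrib)
      qed
      ultimately have "(real n - real i) / lam
          \<le> (real n * exp (- (real i / real n))) / (real n * exp (- (2 * (y / s))))"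
        using n_pos that by (intro frac_le) auto
      also have "\<dots> = exp (2 * (y / s) - real i / real n)"
        using n_pos by (intro exp_quotient) simp
      also have "2 * (y / s) = 2 * y / s" by simp
      finally show ?thesis .
    qed
    have "ratio j \<le> (\<Prod>i<j. exp (2 * y / s - real i / real n))"
      unfolding ratio_def using f that lam_pos by (intro prod_mono) auto
    also have "\<dots> = exp (\<Sum>i<j. 2 * y / s - real i / real n)"
      by (simp add: exp_sum)
    also have "(\<Sum>i<j. 2 * y / s - real i / real n)
        = real j * (2 * y / s) - real j * (real j - 1) / (2 * real n)"
      by (simp add: sum_subtractf sum_divide_distrib[symmetric] sum_real_lessThan)
    \<comment> \<open>With \<open>x = j / s\<close> the exponent is
      \<open>2 * y * x - x^2 / 2 + x / (2 * s)\<close>. Replacing \<open>x^2 / 2\<close> by its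
      tangent at 1 leaves slope at most \<open>1/5 - 1 + 1/2 = - 3/10\<close>.\<close>
    also have "\<dots> \<le> 1 + real j * (- (3 / (10 * s)))"
    proof -
      define x where "x = real j / s"
      have x: "0 \<le> x" "real j = x * s" using s by (simp_all add: x_def)
      have "real j * (real j - 1) / (2 * real n) = x\<^sup>2 / 2 - x / (2 * s)"
        using s unfolding x(2) s(2)[symmetric] by (simp add: field_simps power2_eq_square)
      moreover have "x / (2 * s) \<le> x / 2" using s x by (intro divide_left_mono) auto
      moreover have "real j * (2 * y / s) = x * (2 * y)" "real j * (- (3 / (10 * s))) = - (3 / 10 * x)"
        using s by (simp_all add: x(2))
      moreover have "x * (2 * y) \<le> x * (2 * (1 / 10))"
        using x True by (intro mult_left_mono) auto
      moreover have "0 \<le> (x - 1)\<^sup>2" by simp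
      then have "x - 1 / 2 \<le> x\<^sup>2 / 2" by (simp add: power2_eq_square algebra_simps)
      ultimately show ?thesis by simp
    qed
    finally have "ratio j \<le> exp (1 + real j * (- (3 / (10 * s))))" by simp
    also have "\<dots> = exp 1 * q ^ j"
      unfolding q_def exp_add exp_of_nat_mult ..
    finally show ?thesis .
  qed
  have q: "0 < q" "q < 1" using s by (auto simp: q_def)
  have "W \<le> (\<Sum>j<n. exp 1 * q ^ Suc j)"
    unfolding W_def by (intro sum_mono ratio_le) auto
  also have "\<dots> = exp 1 * (q * (\<Sum>j<n. q ^ j))" by (simp add: sum_distrib_left mult.left_commute)
  also have "\<dots> \<le> exp 1 * (q * (1 / (1 - q)))"
    using q by (intro mult_left_mono) (auto simp: sum_gp_strict divide_right_mono)
  also have "q * (1 / (1 - q)) \<le> 10 / 3 * s"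
  proof -
    have "q * (1 + 3 / (10 * s)) \<le> q * exp (3 / (10 * s))"
      using q by (intro mult_left_mono exp_ge_add_one_self) auto
    also have "\<dots> = 1" by (simp add: q_def exp_add[symmetric])
    finally show ?thesis using q s by (simp add: field_simps)
  qed
  finally have W: "W \<le> exp 1 * (10 / 3 * s)" by simp
  have W0: "0 \<le> W" unfolding W_def by (intro sum_nonneg ratio_nonneg) auto
  have "real n * measure_pmf.prob \<nu> {..<n} = s * y * (1 - measure_pmf.prob \<nu> {..<n}) * W"
    using idle_balance by (simp add: lam W_def s_def)
  also have "\<dots> \<le> s * y * 1 * (exp 1 * (10 / 3 * s))"
    using s y W W0 by (intro mult_mono) auto
  also have "\<dots> = real n * (10 / 3 * exp 1 * y)" by (simp add: s(2)[symmetric])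
  finally have "measure_pmf.prob \<nu> {..<n} \<le> 10 / 3 * exp 1 * y" using n_pos by simp
  also have "\<dots> \<le> 4 * pi * exp 1 * y"
    using pi_gt3 y by (intro mult_right_mono) auto
  finally show ?thesis by (simp add: mult_ac)
qed

text \<open>About \<open>sqrt n\<close> indices \<open>j\<close> between \<open>sqrt n\<close> and
  \<open>2 * sqrt n\<close> have \<open>ratio j \<ge> exp (y - 5)\<close>. The ratio sum is then at
  least \<open>sqrt n * exp (y - 5)\<close>, and \<open>idle_balance\<close> forces the busy
  probability down.\<close>

lemma prob_not_idle_le:
  assumes y: "0 < y" and lam: "lam = real n - sqrt (real n) * y"
  shows "1 - measure_pmf.prob \<nu> {..<n} \<le> 4 * exp 5 * (exp (- y) / y)"
proof -
  define s where "s = sqrt (real n)"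
  have s: "1 \<le> s" "s * s = real n" using n_pos by (auto simp: s_def)
  have "s * y < s * s" using lam lam_pos s by (simp add: s_def)
  then have ys: "y < s" using s(1) by (intro mult_left_less_imp_less[of s y s]) auto
  \<comment> \<open>For \<open>n < 16\<close> the bound is trivial, since \<open>y \<le> 4\<close>
    gives \<open>y * exp y \<le> 4 * exp 5\<close>; the factor 4 comes from here. From 16 on,
    \<open>2 * m \<le> n\<close> holds and \<open>i / n \<le> 1 / 2\<close>, as
    \<open>one_minus_ge_exp\<close> requires.\<close>
  show ?thesis
  proof (cases "n < 16")
    case True
    then have "s \<le> sqrt 16" unfolding s_def by (subst real_sqrt_le_iff) auto
    then have "y \<le> 4" using ys by simp
    then have "y * exp y \<le> 4 * exp 5" using y by (intro mult_mono) auto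
    then have "1 \<le> 4 * exp 5 * (exp (- y) / y)" using y by (simp add: exp_minus field_simps)
    then show ?thesis using measure_nonneg[of \<nu> "{..<n}"] by linarith
  next
    case False
    then have "sqrt 16 \<le> s" unfolding s_def by (subst real_sqrt_le_iff) auto
    then have s4: "4 \<le> s" by simp
    define m where "m = nat \<lceil>s\<rceil>"
    have m: "s \<le> real m" "real m \<le> s + 1" using s by (auto simp: m_def of_nat_ceiling)
    define W where "W = (\<Sum>j<n. ratio (Suc j))"
    have ss: "4 * s \<le> s * s" using s4 by (intro mult_right_mono) auto
    have mn: "2 * m \<le> n"
    proof -
      have "2 * real m \<le> real n" using m ss s4 unfolding s(2)[symmetric] by linarith
      then show ?thesis by linarith
    qed
    have ratio_ge: "exp (y - 5) \<le> ratio j" if j: "m \<le> j" "j < 2 * m" for j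
    proof -
      have f: "exp (y / s - 2 * (real i / real n)) \<le> (real n - real i) / lam" if "i < j" for i
      proof -
        have "i + 2 \<le> 2 * m" using that j by linarith
        then have "real (i + 2) \<le> real (2 * m)" by (simp only: of_nat_le_iff)
        then have "2 * real i \<le> 4 * real m - 4" by simp
        also have "\<dots> \<le> real n" using m ss unfolding s(2)[symmetric] by linarith
        finally have u: "real i / real n \<le> 1 / 2" using n_pos by (simp add: field_simps)
        have "lam = real n * (1 - y / s)"
          using s by (simp add: lam s_def[symmetric] s(2)[symmetric] field_simps)
        also have "\<dots> \<le> real n * exp (- (y / s))"
          using exp_ge_add_one_self[of "- (y / s)"] by (intro mult_left_mono) auto
        finally have "lam \<le> real n * exp (- (y / s))" .
        moreover have "exp (- (2 * (real i / real n))) \<le> 1 - real i / real n"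
          by (rule one_minus_ge_exp[OF _ u]) simp
        then have "real n * exp (- (2 * (real i / real n))) \<le> real n * (1 - real i / real n)"
          by (intro mult_left_mono) auto
        then have "real n * exp (- (2 * (real i / real n))) \<le> real n - real i"
          using n_pos by (simp add: right_diff_distrib)
        ultimately have "(real n * exp (- (2 * (real i / real n)))) / (real n * exp (- (y / s)))
            \<le> (real n - real i) / lam"
          using lam_pos that j mn by (intro frac_le) auto
        moreover have "(real n * exp (- (2 * (real i / real n)))) / (real n * exp (- (y / s)))
            = exp (y / s - 2 * (real i / real n))"
          using n_pos by (intro exp_quotient) simp
        ultimately show ?thesis by simp
      qed
      have jn: "j \<le> n" using j mn by simp
      \<comment> \<open>The linear part is at least \<open>y\<close> because
        \<open>j \<ge> s\<close>; the quadratic loss is at most 5 because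
        \<open>j \<le> 2 * s + 1\<close> and \<open>4 * s \<le> n\<close>.\<close>
      have "y - 5 \<le> real j * (y / s) - real j * (real j - 1) / real n"
      proof -
        have "real j * (real j - 1) \<le> (2 * s + 1) * (2 * s)"
          using j m s by (intro mult_mono) linarith+
        also have "\<dots> \<le> 5 * real n" using ss s unfolding s(2)[symmetric] by (simp add: algebra_simps)
        finally have "real j * (real j - 1) / real n \<le> 5" using n_pos by (simp add: field_simps)
        moreover have "s * (y / s) \<le> real j * (y / s)" using j m y s by (intro mult_right_mono) auto
        ultimately show ?thesis using s by simp
      qed
      also have "\<dots> = (\<Sum>i<j. y / s - 2 * (real i / real n))"
        by (simp add: sum_subtractf sum_distrib_left[symmetric] sum_divide_distrib[symmetric] sum_real_lessThan)
      finally have "exp (y - 5) \<le> (\<Prod>i<j. exp (y / s - 2 * (real i / real n)))"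
        by (simp add: exp_sum[symmetric])
      also have "\<dots> \<le> ratio j"
        unfolding ratio_def using f by (intro prod_mono) auto
      finally show ?thesis .
    qed
    have "s * exp (y - 5) \<le> real m * exp (y - 5)" using m by (intro mult_right_mono) auto
    also have "\<dots> = (\<Sum>j\<in>{m..<2 * m}. exp (y - 5))" by simp
    also have "\<dots> \<le> (\<Sum>j\<in>{m..<2 * m}. ratio j)" by (intro sum_mono ratio_ge) auto
    also have "\<dots> \<le> (\<Sum>j\<in>{Suc 0..n}. ratio j)"
      using mn m s by (intro sum_mono2 ratio_nonneg) auto
    also have "\<dots> = W" unfolding W_def
      by (rule sum.reindex_bij_witness[where j = "\<lambda>j. j - 1" and i = Suc]) auto
    finally have W: "s * exp (y - 5) \<le> W" .
    define b where "b = 1 - measure_pmf.prob \<nu> {..<n}"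
    have b: "0 \<le> b" by (simp add: b_def)
    have "s * y * b * (s * exp (y - 5)) \<le> s * y * b * W"
      using s y b W by (intro mult_left_mono) auto
    also have "\<dots> = real n * (1 - b)" using idle_balance by (simp add: lam W_def s_def b_def)
    also have "\<dots> \<le> real n * 1" using b by (intro mult_left_mono) auto
    finally have "real n * (y * b * exp (y - 5)) \<le> real n * 1"
      unfolding s(2)[symmetric] by (simp add: mult_ac)
    then have "y * b * exp (y - 5) \<le> 1" using n_pos by simp
    then have "b \<le> exp 5 * (exp (- y) / y)" using y by (simp add: exp_diff exp_minus field_simps)
    also have "\<dots> \<le> 4 * exp 5 * (exp (- y) / y)" using y by (intro mult_right_mono) auto
    finally show ?thesis by (simp add: b_def)
  qed
qed

end

section \<open>The two regimes\<close>

lemma arrival_rate_eq: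
  assumes "0 < n"
  shows "arrival_rate \<alpha> n = real n - sqrt (real n) * real n powr (1/2 - \<alpha>)"
proof -
  have "sqrt (real n) * real n powr (1/2 - \<alpha>) = real n powr (1/2 + (1/2 - \<alpha>))"
    using assms by (simp only: powr_add powr_half_sqrt of_nat_0_le_iff)
  also have "1/2 + (1/2 - \<alpha>) = 1 - \<alpha>" by simp
  finally show ?thesis by (simp add: arrival_rate_def)
qed

lemma arrival_rate_bounds:
  assumes "0 < \<alpha>" "2 \<le> n"
  shows "0 < arrival_rate \<alpha> n" "arrival_rate \<alpha> n < real n"
proof -
  have "real n powr (1 - \<alpha>) < real n powr 1"
    using assms by (intro powr_less_mono) auto
  then show "0 < arrival_rate \<alpha> n" using assms by (simp add: arrival_rate_def)
  show "arrival_rate \<alpha> n < real n" using assms by (simp add: arrival_rate_def)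
qed

lemma idle_servers_pos: "{q. 0 < idle_servers n q} = {..<n}"
  by (auto simp: idle_servers_def)

section \<open>Idle probability at time \<open>t\<close>\<close>

context mmn_queue
begin

lemma prob_idle_upper:
  assumes y: "0 < y" and lam: "lam = real n - sqrt (real n) * y"
    and cert: "gap_certificate n lam \<gamma> \<epsilon>" and \<gamma>: "0 < \<gamma>" and t: "0 \<le> t"
  shows "ereal (measure_pmf.prob (law_at P \<mu> t) {..<n})
    \<le> ereal (4 * exp 1 * pi * y) + ereal (2 * sqrt (exp 1 * pi) * sqrt y * exp (- \<gamma> * t)) * chi \<mu> \<nu>"
proof (cases "chi_sq \<mu> \<nu> = \<infinity>")
  case True
  \<comment> \<open>Strict positivity matters: in \<open>ereal\<close> a zero coefficient would turn
    the infinite divergence into 0.\<close>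
  have "0 < 2 * sqrt (exp 1 * pi) * sqrt y * exp (- \<gamma> * t)" using y by simp
  then show ?thesis using True y by (simp add: chi_def)
next
  case False
  define a where "a = measure_pmf.prob \<nu> {..<n}"
  define r where "r = sqrt (enn2real (chi_sq \<mu> \<nu>))"
  have a: "0 \<le> a" "a \<le> 4 * exp 1 * pi * y"
    using prob_idle_le[OF _ lam] y by (auto simp: a_def)
  have "sqrt (a * (1 - a)) \<le> sqrt (4 * (exp 1 * pi) * y)"
    using a mult_left_le[of "1 - a" a] by (intro real_sqrt_le_mono) (auto simp: a_def mult_ac)
  also have "\<dots> = 2 * sqrt (exp 1 * pi) * sqrt y" by (simp add: real_sqrt_mult)
  finally have "sqrt (a * (1 - a)) * exp (- \<gamma> * t) * r
      \<le> 2 * sqrt (exp 1 * pi) * sqrt y * exp (- \<gamma> * t) * r"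
    by (intro mult_right_mono) (auto simp: r_def)
  moreover have "\<bar>measure_pmf.prob (law_at P \<mu> t) {..<n} - a\<bar> \<le> sqrt (a * (1 - a)) * exp (- \<gamma> * t) * r"
    using mixing_bound[OF cert \<gamma> t False] by (simp add: a_def r_def)
  ultimately have "measure_pmf.prob (law_at P \<mu> t) {..<n}
      \<le> 4 * exp 1 * pi * y + 2 * sqrt (exp 1 * pi) * sqrt y * exp (- \<gamma> * t) * r"
    using a by linarith
  then show ?thesis using False by (simp add: chi_def r_def)
qed

lemma prob_idle_lower:
  assumes y: "0 < y" and lam: "lam = real n - sqrt (real n) * y"
    and cert: "gap_certificate n lam \<gamma> \<epsilon>" and \<gamma>: "0 < \<gamma>" and t: "0 \<le> t"
  shows "ereal (1 - 4 * exp 5 * (exp (- y) / y)) - ereal (exp (- \<gamma> * t)) * chi \<mu> \<nu>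
    \<le> ereal (measure_pmf.prob (law_at P \<mu> t) {..<n})"
proof (cases "chi_sq \<mu> \<nu> = \<infinity>")
  case True
  then show ?thesis by (simp add: chi_def)
next
  case False
  define a where "a = measure_pmf.prob \<nu> {..<n}"
  define r where "r = sqrt (enn2real (chi_sq \<mu> \<nu>))"
  have a: "0 \<le> a" "a \<le> 1" "1 - a \<le> 4 * exp 5 * (exp (- y) / y)"
    using prob_not_idle_le[OF y lam] by (auto simp: a_def)
  have "sqrt (a * (1 - a)) \<le> 1"
    using a by (simp add: mult_le_one)
  then have "sqrt (a * (1 - a)) * exp (- \<gamma> * t) * r \<le> 1 * exp (- \<gamma> * t) * r"
    by (intro mult_right_mono) (auto simp: r_def)
  moreover have "\<bar>measure_pmf.prob (law_at P \<mu> t) {..<n} - a\<bar> \<le> sqrt (a * (1 - a)) * exp (- \<gamma> * t) * r"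
    using mixing_bound[OF cert \<gamma> t False] by (simp add: a_def r_def)
  ultimately have "1 - 4 * exp 5 * (exp (- y) / y) - exp (- \<gamma> * t) * r
      \<le> measure_pmf.prob (law_at P \<mu> t) {..<n}"
    using a by linarith
  then show ?thesis using False by (simp add: chi_def r_def)
qed

end

text \<open>Where neither sharp certificate applies, \<open>c\<close> is any available gap divided
  by \<open>(sqrt n - sqrt lam)^2\<close>; for fixed \<open>\<alpha> > 1/2\<close> this concerns
  only finitely many \<open>n\<close>.\<close>

lemma ex_rate_constant:
  assumes "0 < \<alpha>" "2 \<le> n"
  defines "lam \<equiv> arrival_rate \<alpha> n"
  shows "\<exists>c>0. (1 \<le> \<alpha> \<or> real n powr (1/2 - \<alpha>) \<le> 1 / 10 \<longrightarrow> c = 1) \<and>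
    (\<exists>\<epsilon>. gap_certificate n lam (c * (sqrt (real n) - sqrt lam)\<^sup>2) \<epsilon>)"
proof -
  have lam: "0 < lam" "lam < real n" using arrival_rate_bounds[OF assms(1,2)] by (simp_all add: lam_def)
  consider "1 \<le> \<alpha>" | "real n powr (1/2 - \<alpha>) \<le> 1 / 10" | "\<not> (1 \<le> \<alpha> \<or> real n powr (1/2 - \<alpha>) \<le> 1 / 10)"
    by blast
  then show ?thesis
  proof cases
    case 1
    have "real n powr (1 - \<alpha>) \<le> real n powr 0" using 1 assms by (intro powr_mono) auto
    then have "real n - lam \<le> 1" using assms by (simp add: lam_def arrival_rate_def)
    from gap_certificate_sqrt[OF lam(1) _ this] lam show ?thesis by (intro exI[of _ 1]) auto
  next
    case 2
    have "lam = real n - sqrt (real n) * real n powr (1/2 - \<alpha>)"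
      using arrival_rate_eq[of n \<alpha>] assms by (simp add: lam_def)
    from gap_certificate_small_slack[OF _ _ 2 this] assms show ?thesis by (intro exI[of _ 1]) auto
  next
    case 3
    obtain \<gamma> \<epsilon> where g: "0 < \<gamma>" "gap_certificate n lam \<gamma> \<epsilon>" using ex_gap_certificate[OF lam] by blast
    have "sqrt lam < sqrt (real n)" using lam by simp
    then have d: "0 < (sqrt (real n) - sqrt lam)\<^sup>2" by simp
    with g 3 show ?thesis
      by (intro exI[of _ "\<gamma> / (sqrt (real n) - sqrt lam)\<^sup>2"]) auto
  qed
qed

theorem corollary6:
  fixes \<alpha> :: real
  assumes "\<alpha> > 0"
  shows
    "(\<alpha> > 1/2 \<longrightarrow>
       (\<exists>C :: nat \<Rightarrow> real.
          (\<forall>n\<ge>2. C n > 0) \<and>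
          (\<alpha> < 1 \<longrightarrow> C \<longlonglongrightarrow> 1) \<and>
          (\<alpha> \<ge> 1 \<longrightarrow> (\<forall>n\<ge>2. C n = 1)) \<and>
          (\<forall>n\<ge>2. \<forall>P \<nu> \<mu> t.
             mmn_semigroup n (arrival_rate \<alpha> n) P \<longrightarrow> stationary P \<nu> \<longrightarrow> t \<ge> 0 \<longrightarrow>
             ereal (measure_pmf.prob (law_at P \<mu> t) {q. idle_servers n q > 0})
               \<le> ereal (4 * exp 1 * pi * real n powr (1/2 - \<alpha>))
                 + ereal (2 * sqrt (exp 1 * pi) * real n powr (1/4 - \<alpha>/2)
                     * exp (- C n * (sqrt (real n) - sqrt (arrival_rate \<alpha> n))\<^sup>2 * t)) * chi \<mu> \<nu>)))
     \<and>
     (\<alpha> < 1/2 \<longrightarrow>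
       (\<exists>\<kappa>>0. \<exists>D :: nat \<Rightarrow> real.
          (\<forall>n\<ge>2. D n > 0) \<and>
          D \<longlonglongrightarrow> 1/25 \<and>
          (\<forall>n\<ge>2. \<forall>P \<nu> \<mu> t.
             mmn_semigroup n (arrival_rate \<alpha> n) P \<longrightarrow> stationary P \<nu> \<longrightarrow> t \<ge> 0 \<longrightarrow>
             ereal (measure_pmf.prob (law_at P \<mu> t) {q. idle_servers n q > 0})
               \<ge> ereal (1 - \<kappa> * real n powr (\<alpha> - 1/2) * exp (- (real n powr (1/2 - \<alpha>))))
                 - ereal (exp (- D n * t)) * chi \<mu> \<nu>)))"
proof (intro conjI impI)
  have queue: "mmn_queue n (arrival_rate \<alpha> n) P \<nu>"
    if "2 \<le> n" "mmn_semigroup n (arrival_rate \<alpha> n) P" "stationary P \<nu>" for n P \<nu>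
    using that arrival_rate_bounds[OF assms that(1)] by unfold_locales auto
  {
    assume \<alpha>: "1/2 < \<alpha>"
    obtain C where C: "\<And>n. 2 \<le> n \<Longrightarrow> 0 < C n \<and>
      (1 \<le> \<alpha> \<or> real n powr (1/2 - \<alpha>) \<le> 1 / 10 \<longrightarrow> C n = 1) \<and>
      (\<exists>\<epsilon>. gap_certificate n (arrival_rate \<alpha> n)
        (C n * (sqrt (real n) - sqrt (arrival_rate \<alpha> n))\<^sup>2) \<epsilon>)"
      using ex_rate_constant[OF assms] by metis
    \<comment> \<open>The slack parameter eventually drops below 1/10, so \<open>C n\<close> not
      only tends to 1 but is eventually equal to 1.\<close>
    have "(\<lambda>n. real n powr (1/2 - \<alpha>)) \<longlonglongrightarrow> 0"
      using \<alpha> by (intro tendsto_neg_powr filterlim_real_sequentially) auto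
    then have "\<forall>\<^sub>F n in sequentially. real n powr (1/2 - \<alpha>) < 1 / 10"
      by (rule order_tendstoD) simp
    then have "\<forall>\<^sub>F n in sequentially. C n = 1"
      using eventually_ge_at_top[of 2] by eventually_elim (use C in force)
    then have lim: "C \<longlonglongrightarrow> 1" by (rule tendsto_eventually)
    show "\<exists>C. (\<forall>n\<ge>2. C n > 0) \<and>
          (\<alpha> < 1 \<longrightarrow> C \<longlonglongrightarrow> 1) \<and>
          (\<alpha> \<ge> 1 \<longrightarrow> (\<forall>n\<ge>2. C n = 1)) \<and>
          (\<forall>n\<ge>2. \<forall>P \<nu> \<mu> t.
             mmn_semigroup n (arrival_rate \<alpha> n) P \<longrightarrow> stationary P \<nu> \<longrightarrow> t \<ge> 0 \<longrightarrow>
             ereal (measure_pmf.prob (law_at P \<mu> t) {q. idle_servers n q > 0})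
               \<le> ereal (4 * exp 1 * pi * real n powr (1/2 - \<alpha>))
                 + ereal (2 * sqrt (exp 1 * pi) * real n powr (1/4 - \<alpha>/2)
                     * exp (- C n * (sqrt (real n) - sqrt (arrival_rate \<alpha> n))\<^sup>2 * t)) * chi \<mu> \<nu>)"
    proof (intro exI[of _ C] conjI allI impI)
      fix n P \<nu> \<mu> and t :: real
      assume n: "2 \<le> n" and P: "mmn_semigroup n (arrival_rate \<alpha> n) P" "stationary P \<nu>" and t: "0 \<le> t"
      interpret mmn_queue n "arrival_rate \<alpha> n" P \<nu> by (rule queue[OF n P])
      obtain \<epsilon> where cert: "gap_certificate n (arrival_rate \<alpha> n)
          (C n * (sqrt (real n) - sqrt (arrival_rate \<alpha> n))\<^sup>2) \<epsilon>"
        using C[OF n] by blast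
      have "sqrt (arrival_rate \<alpha> n) < sqrt (real n)" using lam_less by simp
      then have pos: "0 < C n * (sqrt (real n) - sqrt (arrival_rate \<alpha> n))\<^sup>2"
        using C[OF n] by simp
      have y: "0 < real n powr (1/2 - \<alpha>)" using n by simp
      have "sqrt (real n powr (1/2 - \<alpha>)) = real n powr (1/4 - \<alpha>/2)"
        by (simp add: powr_half_sqrt[symmetric] powr_powr field_simps)
      then show "ereal (measure_pmf.prob (law_at P \<mu> t) {q. idle_servers n q > 0})
               \<le> ereal (4 * exp 1 * pi * real n powr (1/2 - \<alpha>))
                 + ereal (2 * sqrt (exp 1 * pi) * real n powr (1/4 - \<alpha>/2)
                     * exp (- C n * (sqrt (real n) - sqrt (arrival_rate \<alpha> n))\<^sup>2 * t)) * chi \<mu> \<nu>"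
        using prob_idle_upper[OF y arrival_rate_eq cert pos t, of \<mu>] n
        by (simp add: idle_servers_pos)
    qed (use C lim in auto)
  }
  {
    assume \<alpha>: "\<alpha> < 1/2"
    show "\<exists>\<kappa>>0. \<exists>D :: nat \<Rightarrow> real.
          (\<forall>n\<ge>2. D n > 0) \<and>
          D \<longlonglongrightarrow> 1/25 \<and>
          (\<forall>n\<ge>2. \<forall>P \<nu> \<mu> t.
             mmn_semigroup n (arrival_rate \<alpha> n) P \<longrightarrow> stationary P \<nu> \<longrightarrow> t \<ge> 0 \<longrightarrow>
             ereal (measure_pmf.prob (law_at P \<mu> t) {q. idle_servers n q > 0})
               \<ge> ereal (1 - \<kappa> * real n powr (\<alpha> - 1/2) * exp (- (real n powr (1/2 - \<alpha>))))
                 - ereal (exp (- D n * t)) * chi \<mu> \<nu>)"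
    \<comment> \<open>Here \<open>y \<ge> 1\<close> for every \<open>n \<ge> 2\<close>, so one
      certificate serves all \<open>n\<close> and \<open>D\<close> can be constant;
      \<open>\<kappa>\<close> is the constant of \<open>prob_not_idle_le\<close>.\<close>
    proof (intro exI[of _ "4 * exp 5 :: real"] exI[of _ "\<lambda>_. 1/25 :: real"] conjI allI impI)
      fix n P \<nu> \<mu> and t :: real
      assume n: "2 \<le> n" and P: "mmn_semigroup n (arrival_rate \<alpha> n) P" "stationary P \<nu>" and t: "0 \<le> t"
      interpret mmn_queue n "arrival_rate \<alpha> n" P \<nu> by (rule queue[OF n P])
      define y where "y = real n powr (1/2 - \<alpha>)"
      have y: "1 \<le> y" unfolding y_def using n \<alpha> by (intro ge_one_powr_ge_zero) auto
      have lam: "arrival_rate \<alpha> n = real n - sqrt (real n) * y"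
        using arrival_rate_eq[of n \<alpha>] n by (simp add: y_def)
      have "real n powr (\<alpha> - 1/2) = 1 / y"
        unfolding y_def using powr_minus_divide[of "real n" "1/2 - \<alpha>"] by simp
      then show "ereal (measure_pmf.prob (law_at P \<mu> t) {q. idle_servers n q > 0})
               \<ge> ereal (1 - 4 * exp 5 * real n powr (\<alpha> - 1/2) * exp (- (real n powr (1/2 - \<alpha>))))
                 - ereal (exp (- (1/25) * t)) * chi \<mu> \<nu>"
        using prob_idle_lower[OF _ lam gap_certificate_large_slack[OF n_pos y lam lam_pos] _ t, of \<mu>] y
        by (simp add: idle_servers_pos y_def[symmetric])
    qed auto
  }
qed

end
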